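(* Let $d>1$ and let $F(\mathbf{x})\in\mathbb{Z}[x_1,\ldots,x_n]$ be a homogeneous form of degree $d$. Define the bihomogeneous form $G(\mathbf{x};\mathbf{y})=F(x_1y_1,\ldots,x_ny_n)$ in $\mathbf{x}=(x_1,\ldots,x_n)$, $\mathbf{y}=(y_1,\ldots,y_n)$. Then $$\min\{\operatorname{codim}V^*_{G,1},\operatorname{codim}V^*_{G,2}\}\ge\frac{\operatorname{codim}V_F^*}{2}.$$
   Context: $V_F^*=\{\mathbf{z}\in\mathbb{C}^n:\partial F/\partial x_j(\mathbf{z})=0\ (1\le j\le n)\}\subseteq\mathbb{A}^n_{\mathbb{C}}$ with $\operatorname{codim}V_F^*=n-\dim V_F^*$. $V^*_{G,1}=\{(\mathbf{x},\mathbf{y})\in\mathbb{C}^{2n}:\partial G/\partial x_j(\mathbf{x},\mathbf{y})=0\ (1\le j\le n)\}$ and $V^*_{G,2}=\{(\mathbf{x},\mathbf{y})\in\mathbb{C}^{2n}:\partial G/\partial y_j(\mathbf{x},\mathbf{y})=0\ (1\le j\le n)\}$, affine varieties in $\mathbb{A}^{2n}_{\mathbb{C}}$ with codimension $2n-\dim$. *)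

theory Defs
  imports "HOL-Analysis.Analysis" "HOL-Library.Poly_Mapping"
begin

(* Monomials in variables x_0, x_1, ... : exponent vectors with finite support *)
type_synonym mono = "nat \<Rightarrow>\<^sub>0 nat"

definition mon_eval :: "mono \<Rightarrow> (nat \<Rightarrow> complex) \<Rightarrow> complex" where
  "mon_eval m z = (\<Prod>i\<in>Poly_Mapping.keys m. z i ^ Poly_Mapping.lookup m i)"

definition mon_deg :: "mono \<Rightarrow> nat" where
  "mon_deg m = (\<Sum>i\<in>Poly_Mapping.keys m. Poly_Mapping.lookup m i)"

definition ieval :: "(mono \<Rightarrow>\<^sub>0 int) \<Rightarrow> (nat \<Rightarrow> complex) \<Rightarrow> complex" where
  "ieval F z = (\<Sum>m\<in>Poly_Mapping.keys F. of_int (Poly_Mapping.lookup F m) * mon_eval m z)"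

definition ceval :: "(mono \<Rightarrow>\<^sub>0 complex) \<Rightarrow> (nat \<Rightarrow> complex) \<Rightarrow> complex" where
  "ceval p z = (\<Sum>m\<in>Poly_Mapping.keys p. Poly_Mapping.lookup p m * mon_eval m z)"

definition is_form :: "nat \<Rightarrow> nat \<Rightarrow> (mono \<Rightarrow>\<^sub>0 int) \<Rightarrow> bool" where
  "is_form n d F \<longleftrightarrow> (\<forall>m\<in>Poly_Mapping.keys F. mon_deg m = d \<and> Poly_Mapping.keys m \<subseteq> {..<n})"

definition aff :: "nat \<Rightarrow> (nat \<Rightarrow> complex) set" where
  "aff n = {z. \<forall>i\<ge>n. z i = 0}"

definition zariski_closed :: "nat \<Rightarrow> (nat \<Rightarrow> complex) set \<Rightarrow> bool" where
  "zariski_closed n S \<longleftrightarrow>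
     (\<exists>P :: (mono \<Rightarrow>\<^sub>0 complex) set. S = {z \<in> aff n. \<forall>p\<in>P. ceval p z = 0})"

definition zariski_irred :: "nat \<Rightarrow> (nat \<Rightarrow> complex) set \<Rightarrow> bool" where
  "zariski_irred n S \<longleftrightarrow> zariski_closed n S \<and> S \<noteq> {} \<and>
     (\<forall>A B. zariski_closed n A \<and> zariski_closed n B \<and> S = A \<union> B \<longrightarrow> S = A \<or> S = B)"

definition var_dim :: "nat \<Rightarrow> (nat \<Rightarrow> complex) set \<Rightarrow> nat" where
  "var_dim n V = Sup {k. \<exists>Z :: nat \<Rightarrow> (nat \<Rightarrow> complex) set.
       (\<forall>i\<le>k. zariski_irred n (Z i) \<and> Z i \<subseteq> V) \<and> (\<forall>i<k. Z i \<subset> Z (Suc i))}"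

definition codim :: "nat \<Rightarrow> (nat \<Rightarrow> complex) set \<Rightarrow> real" where
  "codim n V = real n - real (var_dim n V)"

definition pd :: "((nat \<Rightarrow> complex) \<Rightarrow> complex) \<Rightarrow> nat \<Rightarrow> (nat \<Rightarrow> complex) \<Rightarrow> complex" where
  "pd f j z = deriv (\<lambda>t. f (z(j := t))) (z j)"

definition VF :: "nat \<Rightarrow> (mono \<Rightarrow>\<^sub>0 int) \<Rightarrow> (nat \<Rightarrow> complex) set" where
  "VF n F = {z \<in> aff n. \<forall>j<n. pd (ieval F) j z = 0}"

(* G(x;y) = F(x_1 y_1, ..., x_n y_n), with x_j = w j and y_j = w (n+j) *)
definition Gfun :: "nat \<Rightarrow> (mono \<Rightarrow>\<^sub>0 int) \<Rightarrow> (nat \<Rightarrow> complex) \<Rightarrow> complex" where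
  "Gfun n F w = ieval F (\<lambda>i. if i < n then w i * w (n + i) else 0)"

definition VG1 :: "nat \<Rightarrow> (mono \<Rightarrow>\<^sub>0 int) \<Rightarrow> (nat \<Rightarrow> complex) set" where
  "VG1 n F = {w \<in> aff (2*n). \<forall>j<n. pd (Gfun n F) j w = 0}"

definition VG2 :: "nat \<Rightarrow> (mono \<Rightarrow>\<^sub>0 int) \<Rightarrow> (nat \<Rightarrow> complex) set" where
  "VG2 n F = {w \<in> aff (2*n). \<forall>j<n. pd (Gfun n F) (n + j) w = 0}"

end

theory Submission
  imports Defs "HOL-Library.Function_Algebras"
    "HOL-Computational_Algebra.Fundamental_Theorem_Algebra"
begin

text \<open>
  Let \<open>D\<^sub>j\<close> be the partial derivatives of \<open>F\<close>, and let \<open>z\<close> be the vector of products \<open>x\<^sub>j y\<^sub>j\<close>. The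
  first locus is cut out by \<open>y\<^sub>j D\<^sub>j(z) = 0\<close>. On the stratum where exactly the \<open>y\<^sub>j\<close> with \<open>j \<in> J\<close> vanish,
  \<open>|J| = k\<close>, the point \<open>z\<close> lies in the cone \<open>W\<^sub>J\<close> given by \<open>z\<^sub>j = 0\<close> for \<open>j \<in> J\<close> and \<open>D\<^sub>j(z) = 0\<close> for
  \<open>j \<notin> J\<close>, and the stratum has dimension at most \<open>n + dim W\<^sub>J\<close>. Clearly \<open>dim W\<^sub>J \<le> n - k\<close>; and the \<open>k\<close>
  forms \<open>D\<^sub>j\<close>, \<open>j \<in> J\<close>, cut \<open>W\<^sub>J\<close> down to a subset of the singular locus of \<open>F\<close>, of dimension \<open>\<delta>\<close>, so
  \<open>dim W\<^sub>J \<le> k + \<delta>\<close>. Adding the two bounds gives \<open>2 dim W\<^sub>J \<le> n + \<delta>\<close>.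

  Upper bounds on dimensions are obtained from the growth of Hilbert functions: a chain of length \<open>k\<close>
  of irreducible sets forces growth of order \<open>s\<^sup>k\<close>. If a cone is cut down to the origin by \<open>m\<close>
  forms of positive degree, then the Nullstellensatz bounds its growth by \<open>s\<^sup>m\<close>; and a cone of Krull
  dimension \<open>\<delta>\<close> is cut down to the origin by \<open>\<delta>\<close> generic hyperplanes, since each of them avoids a
  chosen nonzero point of every component.
\<close>

subsection \<open>Spaces of complex-valued functions\<close>

text \<open>Dimension is given by chains of irreducible closed sets, but the strata are only locally
  closed and are related to the cones by a map. Growth of restricted polynomials makes sense for
  arbitrary sets, passes to subsets and finite unions, and can be followed along such a map, so the
  estimates are made there. Chains have to be turned into equations only once, for the singular
  locus of \<open>F\<close>; this takes hyperplane sections, hence finitely many irreducible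
  components, hence Hilbert's basis theorem. The cone structure matters in that step: the origin
  survives every section by a hyperplane through it, so a section of a nonempty cone always carries
  at least the chain consisting of the origin. The Nullstellensatz shows that, on a cone where some
  forms vanish together only at the origin, high powers of the coordinates are combinations of these
  forms. The functions on the cone are then a finite module over the polynomials in the forms. The
  condition \<open>d > 1\<close> makes the partial derivatives forms of positive degree, which is
  what lets this reduction lower degrees.\<close>

definition cscale :: "complex \<Rightarrow> ('a \<Rightarrow> complex) \<Rightarrow> 'a \<Rightarrow> complex" where
  "cscale c f = (\<lambda>z. c * f z)"

lemma cscale_apply [simp]: "cscale c f z = c * f z"
  by (simp add: cscale_def)

interpretation fv: vector_space "cscale :: complex \<Rightarrow> ('a \<Rightarrow> complex) \<Rightarrow> _"
  by unfold_locales (auto simp: algebra_simps)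

lemma sum_fun_apply: "(\<Sum>i\<in>A. f i) z = (\<Sum>i\<in>A. f i z)"
  for f :: "'i \<Rightarrow> 'a \<Rightarrow> 'b :: comm_monoid_add"
  by (induction A rule: infinite_finite_induct) auto

lemma prod_fun_apply: "(\<Prod>i\<in>A. f i) z = (\<Prod>i\<in>A. f i z)"
  for f :: "'i \<Rightarrow> 'a \<Rightarrow> 'b :: comm_monoid_mult"
  by (induction A rule: infinite_finite_induct) auto

lemma power_fun_apply: "(f ^ k) z = f z ^ k"
  for f :: "'a \<Rightarrow> 'b :: monoid_mult"
  by (induction k) auto

lemma cscale_eq_mult: "cscale c f = (\<lambda>_. c) * f"
  by (auto simp: fun_eq_iff)

lemma mult_cscale: "f * cscale c g = cscale c (f * g)"
  and cscale_mult: "cscale c f * g = cscale c (f * g)"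
  by (auto simp: fun_eq_iff)

text \<open>Multiplication is bilinear, so products of generators decide; each factor in turn is
  extended from generators to the span.\<close>

lemma span_mult_mem:
  assumes "fv.subspace C" and AB: "\<And>x y. x \<in> A \<Longrightarrow> y \<in> B \<Longrightarrow> x * y \<in> C"
    and f: "f \<in> fv.span A" and g: "g \<in> fv.span B"
  shows "f * g \<in> C"
proof -
  have "fv.span B \<subseteq> {g. x * g \<in> C}" if "x \<in> A" for x
  proof (rule fv.span_minimal)
    show "fv.subspace {g. x * g \<in> C}"
      using assms(1) by (auto simp: fv.subspace_def mult_cscale distrib_left simp del: cscale_apply)
  qed (use that AB in auto)
  moreover have "fv.span A \<subseteq> {f. f * g \<in> C}"
  proof (rule fv.span_minimal)
    show "fv.subspace {f. f * g \<in> C}"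
      using assms(1) by (auto simp: fv.subspace_def cscale_mult distrib_right simp del: cscale_apply)
  qed (use calculation g in auto)
  ultimately show ?thesis using f by auto
qed

text \<open>The vectors form a family, so repetitions are possible: two equal members give the
  relation with coefficients 1 and -1, and an injective family is dependent by the exchange
  bound.\<close>

lemma ex_relation_of_span:
  assumes T: "finite T" and S: "finite S" and lt: "card T < card S"
    and p: "\<And>i. i \<in> S \<Longrightarrow> p i \<in> fv.span T"
  shows "\<exists>a. (\<exists>i\<in>S. a i \<noteq> 0) \<and> (\<Sum>i\<in>S. cscale (a i) (p i)) = 0"
proof (cases "inj_on p S")
  case True
  have "fv.dependent (p ` S)"
  proof (rule ccontr)
    assume "fv.independent (p ` S)"
    then have "card (p ` S) \<le> card T"
      using fv.independent_span_bound[OF T, of "p ` S"] p by blast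
    then show False using lt card_image[OF True] by simp
  qed
  then obtain u v where u: "v \<in> p ` S" "u v \<noteq> 0" "(\<Sum>v\<in>p ` S. cscale (u v) v) = 0"
    using fv.dependent_finite[of "p ` S"] S by auto
  then have "(\<Sum>i\<in>S. cscale (u (p i)) (p i)) = 0"
    by (simp add: sum.reindex[OF True])
  then show ?thesis using u(1,2) by (intro exI[of _ "u \<circ> p"]) auto
next
  case False
  then obtain i j where ij: "i \<in> S" "j \<in> S" "p i = p j" "i \<noteq> j" by (auto simp: inj_on_def)
  define a where "a = (\<lambda>l. if l = i then 1 else if l = j then - 1 else (0::complex))"
  have "(\<Sum>l\<in>S. cscale (a l) (p l)) = (\<Sum>l\<in>{i, j}. cscale (a l) (p l))"
    by (rule sum.mono_neutral_right) (use ij S in \<open>auto simp: a_def fun_eq_iff\<close>)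
  also have "\<dots> = 0" using ij by (auto simp: a_def fun_eq_iff)
  finally show ?thesis using ij(1) by (intro exI[of _ a]) (auto simp: a_def)
qed

subsection \<open>Polynomial functions\<close>

text \<open>Polynomials are treated as functions rather than as the formal objects evaluated by
  \<open>ceval\<close>, so that pointwise ring operations and spans of functions apply directly.
  Only the values of \<open>e\<close> below \<open>n\<close> matter.\<close>

definition monom_fun :: "nat \<Rightarrow> (nat \<Rightarrow> nat) \<Rightarrow> (nat \<Rightarrow> complex) \<Rightarrow> complex" where
  "monom_fun n e z = (\<Prod>i<n. z i ^ e i)"

definition poly_fun :: "nat \<Rightarrow> ((nat \<Rightarrow> complex) \<Rightarrow> complex) set" where
  "poly_fun n = fv.span (range (monom_fun n))"

definition poly_fun_le :: "nat \<Rightarrow> nat \<Rightarrow> ((nat \<Rightarrow> complex) \<Rightarrow> complex) set" where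
  "poly_fun_le n s = fv.span {monom_fun n e | e. (\<Sum>i<n. e i) \<le> s}"

lemma monom_fun_mult: "monom_fun n e * monom_fun n e' = monom_fun n (\<lambda>i. e i + e' i)"
  by (auto simp: monom_fun_def fun_eq_iff power_add prod.distrib)

lemma monom_fun_cong: "(\<And>i. i < n \<Longrightarrow> e i = e' i) \<Longrightarrow> monom_fun n e = monom_fun n e'"
  by (auto simp: monom_fun_def fun_eq_iff)

lemma subspace_poly_fun: "fv.subspace (poly_fun n)"
  by (simp add: poly_fun_def)

lemma subspace_poly_fun_le: "fv.subspace (poly_fun_le n s)"
  by (simp add: poly_fun_le_def)

lemma poly_fun_le_subset: "poly_fun_le n s \<subseteq> poly_fun n"
  unfolding poly_fun_def poly_fun_le_def by (rule fv.span_mono) auto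

lemma poly_fun_le_mono: "s \<le> t \<Longrightarrow> poly_fun_le n s \<subseteq> poly_fun_le n t"
  unfolding poly_fun_le_def by (rule fv.span_mono) auto

lemma poly_fun_obtain_deg:
  assumes "f \<in> poly_fun n" obtains s where "f \<in> poly_fun_le n s"
proof -
  have "\<exists>s. f \<in> poly_fun_le n s"
    using assms unfolding poly_fun_def
  proof (induction rule: fv.span_induct_alt)
    case base
    then show ?case using fv.subspace_0[OF subspace_poly_fun_le] by blast
  next
    case (step c x y)
    then obtain s e where s: "y \<in> poly_fun_le n s" and x: "x = monom_fun n e" by auto
    let ?t = "max s (\<Sum>i<n. e i)"
    have "x \<in> poly_fun_le n ?t" unfolding poly_fun_le_def x by (rule fv.span_base) auto
    moreover have "y \<in> poly_fun_le n ?t" using s poly_fun_le_mono[of s ?t n] by auto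
    ultimately show ?case
      by (blast intro: fv.subspace_add fv.subspace_scale subspace_poly_fun_le)
  qed
  then show ?thesis using that by blast
qed

lemma poly_fun_le_mult:
  assumes "f \<in> poly_fun_le n a" "g \<in> poly_fun_le n b"
  shows "f * g \<in> poly_fun_le n (a + b)"
proof (rule span_mult_mem[OF subspace_poly_fun_le _ assms[unfolded poly_fun_le_def]])
  fix x y assume "x \<in> {monom_fun n e |e. (\<Sum>i<n. e i) \<le> a}" "y \<in> {monom_fun n e |e. (\<Sum>i<n. e i) \<le> b}"
  then show "x * y \<in> poly_fun_le n (a + b)"
    unfolding poly_fun_le_def
    by (intro fv.span_base) (force simp: monom_fun_mult sum.distrib)
qed

lemma poly_fun_mult:
  assumes "f \<in> poly_fun n" "g \<in> poly_fun n" shows "f * g \<in> poly_fun n"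
proof -
  obtain a where a: "f \<in> poly_fun_le n a" by (rule poly_fun_obtain_deg[OF assms(1)])
  obtain b where b: "g \<in> poly_fun_le n b" by (rule poly_fun_obtain_deg[OF assms(2)])
  show ?thesis by (rule subsetD[OF poly_fun_le_subset poly_fun_le_mult[OF a b]])
qed

lemma one_in_poly_fun_le: "1 \<in> poly_fun_le n 0"
proof -
  have "1 = monom_fun n (\<lambda>_. 0)" by (auto simp: monom_fun_def)
  then show ?thesis unfolding poly_fun_le_def by (intro fv.span_base) auto
qed

lemma const_in_poly_fun_le: "(\<lambda>_. c) \<in> poly_fun_le n s"
proof -
  have "cscale c 1 \<in> poly_fun_le n 0"
    by (intro fv.subspace_scale subspace_poly_fun_le one_in_poly_fun_le)
  then have "cscale c 1 \<in> poly_fun_le n s" using poly_fun_le_mono[of 0 s n] by blast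
  then show ?thesis by (simp add: cscale_def)
qed

lemma monom_fun_single:
  assumes "i < n" shows "monom_fun n (\<lambda>l. if l = i then k else 0) z = z i ^ k"
proof -
  have "monom_fun n (\<lambda>l. if l = i then k else 0) z = (\<Prod>l<n. if l = i then z i ^ k else 1)"
    unfolding monom_fun_def by (rule prod.cong) auto
  then show ?thesis using assms by simp
qed

lemma var_power_in_poly_fun_le: 
  assumes "i < n" shows "(\<lambda>z. z i ^ k) \<in> poly_fun_le n k"
proof -
  have "(\<lambda>z. z i ^ k) = monom_fun n (\<lambda>l. if l = i then k else 0)"
    using assms by (auto simp: monom_fun_single)
  then show ?thesis unfolding poly_fun_le_def
    using assms by (intro fv.span_base) auto
qed

lemma const_in_poly_fun: "(\<lambda>_. c) \<in> poly_fun n"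
  by (rule subsetD[OF poly_fun_le_subset const_in_poly_fun_le[of _ n 0]])

lemma var_in_poly_fun: "i < n \<Longrightarrow> (\<lambda>z. z i) \<in> poly_fun n"
  using var_power_in_poly_fun_le[of i n 1] poly_fun_le_subset by auto

lemma zero_in_poly_fun: "0 \<in> poly_fun n"
  by (rule fv.subspace_0[OF subspace_poly_fun])

lemma one_in_poly_fun: "1 \<in> poly_fun n"
  using one_in_poly_fun_le poly_fun_le_subset by blast

lemma poly_fun_add: "f \<in> poly_fun n \<Longrightarrow> g \<in> poly_fun n \<Longrightarrow> f + g \<in> poly_fun n"
  by (rule fv.subspace_add[OF subspace_poly_fun])

lemma poly_fun_diff: "f \<in> poly_fun n \<Longrightarrow> g \<in> poly_fun n \<Longrightarrow> f - g \<in> poly_fun n"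
  by (rule fv.subspace_diff[OF subspace_poly_fun])

lemma poly_fun_scale: "f \<in> poly_fun n \<Longrightarrow> cscale c f \<in> poly_fun n"
  by (rule fv.subspace_scale[OF subspace_poly_fun])

lemma poly_fun_sum: "(\<And>i. i \<in> A \<Longrightarrow> f i \<in> poly_fun n) \<Longrightarrow> (\<Sum>i\<in>A. f i) \<in> poly_fun n"
  by (rule fv.subspace_sum[OF subspace_poly_fun])

lemma poly_fun_prod: "(\<And>i. i \<in> A \<Longrightarrow> f i \<in> poly_fun n) \<Longrightarrow> (\<Prod>i\<in>A. f i) \<in> poly_fun n"
proof (induction A rule: infinite_finite_induct)
  case (insert i A)
  show ?case unfolding prod.insert[OF insert(1,2)]
    by (rule poly_fun_mult) (use insert in auto)
qed (simp_all only: prod.infinite prod.empty one_in_poly_fun not_False_eq_True)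

lemma poly_fun_power: "f \<in> poly_fun n \<Longrightarrow> f ^ k \<in> poly_fun n"
proof (induction k)
  case (Suc k)
  then show ?case unfolding power_Suc by (intro poly_fun_mult)
qed (simp only: power_0 one_in_poly_fun)

text \<open>Restriction to a line, congruence modulo an ideal and degree in the last variable behave
  well under sums and products, so induction over the ring operations suits them better than
  induction over a span of monomials. Membership in \<open>poly_fun n\<close> is carried along
  because the cases \<open>add\<close> and \<open>mult\<close> assume it.\<close>

lemma poly_fun_induct [consumes 1, case_names const var add mult]:
  assumes "f \<in> poly_fun n"
    and const: "\<And>c. Q (\<lambda>_. c)" and var: "\<And>i. i < n \<Longrightarrow> Q (\<lambda>z. z i)"
    and add: "\<And>f g. f \<in> poly_fun n \<Longrightarrow> g \<in> poly_fun n \<Longrightarrow> Q f \<Longrightarrow> Q g \<Longrightarrow> Q (f + g)"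
    and mult: "\<And>f g. f \<in> poly_fun n \<Longrightarrow> g \<in> poly_fun n \<Longrightarrow> Q f \<Longrightarrow> Q g \<Longrightarrow> Q (f * g)"
  shows "Q f"
proof -
  let ?R = "\<lambda>f. f \<in> poly_fun n \<and> Q f"
  have one: "?R 1" using const[of 1] one_in_poly_fun[of n] by (simp add: one_fun_def)
  have Rmult: "?R (f * g)" if "?R f" "?R g" for f g
    using that mult poly_fun_mult by auto
  have pow: "?R ((\<lambda>z. z i) ^ k)" if "i < n" for i k
  proof (induction k)
    case 0
    show ?case unfolding power_0 by (rule one)
  next
    case (Suc k)
    show ?case unfolding power_Suc
      by (rule Rmult[OF conjI[OF var_in_poly_fun[OF that] var[OF that]] Suc])
  qed
  have prd: "?R (\<Prod>i\<in>A. (\<lambda>z. z i) ^ e i)" if "A \<subseteq> {..<n}" for A e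
    using finite_subset[OF that finite_lessThan] that
  proof (induction A rule: finite_induct)
    case empty
    show ?case unfolding prod.empty by (rule one)
  next
    case (insert i A)
    show ?case unfolding prod.insert[OF insert(1,2)]
      by (rule Rmult[OF pow insert.IH]) (use insert in auto)
  qed
  have mon: "monom_fun n e = (\<Prod>i<n. (\<lambda>z. z i) ^ e i)" for e
    by (auto simp: monom_fun_def fun_eq_iff prod_fun_apply power_fun_apply)
  have "poly_fun n \<subseteq> Collect ?R" unfolding poly_fun_def
  proof (rule fv.span_minimal)
    show "range (monom_fun n) \<subseteq> Collect (\<lambda>f. f \<in> fv.span (range (monom_fun n)) \<and> Q f)"
      using mon prd unfolding poly_fun_def by auto
    have "Q (cscale c x)" if "?R x" for c x
      unfolding cscale_eq_mult using that by (intro mult const const_in_poly_fun) auto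
    then show "fv.subspace (Collect (\<lambda>f. f \<in> fv.span (range (monom_fun n)) \<and> Q f))"
      using add const[of 0, folded zero_fun_def] unfolding poly_fun_def
      by (auto simp: fv.subspace_def fv.span_zero fv.span_add fv.span_scale)
  qed
  then show ?thesis using assms(1) by blast
qed

lemma poly_fun_Suc:
  assumes "f \<in> poly_fun n" shows "f \<in> poly_fun (Suc n)"
  by (rule poly_fun_induct[OF assms, of "\<lambda>f. f \<in> poly_fun (Suc n)"])
    (auto intro: const_in_poly_fun var_in_poly_fun poly_fun_add poly_fun_mult)

lemma monom_fun_homogeneous: "monom_fun n e (\<lambda>i. c * z i) = c ^ (\<Sum>i<n. e i) * monom_fun n e z"
  by (simp add: monom_fun_def power_mult_distrib prod.distrib power_sum)

text \<open>Makes the finiteness of roots of univariate polynomials available on lines through the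
  origin.\<close>

lemma poly_fun_on_line:
  assumes "f \<in> poly_fun n"
  shows "\<exists>q. \<forall>c. f (\<lambda>i. c * z i) = poly q c"
  using assms
proof (induction rule: poly_fun_induct)
  case (const c)
  then show ?case by (intro exI[of _ "[:c:]"]) auto
next
  case (var i)
  then show ?case by (intro exI[of _ "[:0, z i:]"]) auto
next
  case (add f g)
  then obtain p q where "\<forall>c. f (\<lambda>i. c * z i) = poly p c" "\<forall>c. g (\<lambda>i. c * z i) = poly q c" by auto
  then show ?case by (intro exI[of _ "p + q"]) auto
next
  case (mult f g)
  then obtain p q where "\<forall>c. f (\<lambda>i. c * z i) = poly p c" "\<forall>c. g (\<lambda>i. c * z i) = poly q c" by auto
  then show ?case by (intro exI[of _ "p * q"]) auto
qed

subsection \<open>Zariski closed sets\<close>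

lemma ceval_superset:
  assumes "finite A" "Poly_Mapping.keys p \<subseteq> A"
  shows "ceval p z = (\<Sum>m\<in>A. Poly_Mapping.lookup p m * mon_eval m z)"
  unfolding ceval_def by (rule sum.mono_neutral_left) (use assms in \<open>auto simp: in_keys_iff\<close>)

lemma ceval_add: "ceval (p + q) z = ceval p z + ceval q z"
proof -
  let ?A = "Poly_Mapping.keys p \<union> Poly_Mapping.keys q"
  have "ceval (p + q) z = (\<Sum>m\<in>?A. Poly_Mapping.lookup (p + q) m * mon_eval m z)"
    by (rule ceval_superset) (auto simp: Poly_Mapping.keys_add)
  then show ?thesis
    by (simp add: lookup_add ring_distribs sum.distrib ceval_superset[of ?A])
qed

lemma ceval_single: "ceval (Poly_Mapping.single m c) z = c * mon_eval m z"
  by (subst ceval_superset[of "{m}"]) auto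

lemma mon_eval_eq_monom_fun:
  assumes "Poly_Mapping.keys m \<subseteq> {..<n}"
  shows "mon_eval m z = monom_fun n (Poly_Mapping.lookup m) z"
  unfolding mon_eval_def monom_fun_def
  by (rule prod.mono_neutral_left) (use assms in \<open>auto simp: in_keys_iff\<close>)

lemma monom_fun_eq_mon_eval: "\<exists>m. \<forall>z. monom_fun n e z = mon_eval m z"
proof -
  let ?g = "\<lambda>i. if i < n then e i else 0"
  have fin: "finite {i. ?g i \<noteq> 0}" by (rule finite_subset[of _ "{..<n}"]) auto
  define m where "m = Abs_poly_mapping ?g"
  have l: "Poly_Mapping.lookup m = ?g" unfolding m_def using fin by (simp add: Abs_poly_mapping_inverse)
  have "Poly_Mapping.keys m \<subseteq> {..<n}" by (auto simp: in_keys_iff l split: if_splits)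
  then have "mon_eval m z = monom_fun n e z" for z
    using mon_eval_eq_monom_fun[of m n z] unfolding l by (simp add: monom_fun_def)
  then show ?thesis by metis
qed

lemma poly_fun_eq_ceval: 
  assumes "f \<in> poly_fun n" shows "\<exists>p. ceval p = f"
  using assms unfolding poly_fun_def
proof (induction rule: fv.span_induct_alt)
  case base
  have "ceval 0 = 0" by (auto simp: ceval_def)
  then show ?case by blast
next
  case (step c x y)
  then obtain p e where p: "ceval p = y" and x: "x = monom_fun n e" by auto
  obtain m where m: "\<forall>z. monom_fun n e z = mon_eval m z" using monom_fun_eq_mon_eval by blast
  have "ceval (Poly_Mapping.single m c + p) = cscale c x + y"
    by (auto simp: ceval_add ceval_single p x m)
  then show ?case by blast
qed

text \<open>A monomial containing a variable with index at least \<open>n\<close> vanishes on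
  \<open>aff n\<close>; discarding these leaves a polynomial in \<open>n\<close> variables.\<close>

lemma ceval_eq_poly_fun:
  "\<exists>f\<in>poly_fun n. \<forall>z\<in>aff n. ceval p z = f z"
proof -
  let ?K = "{m \<in> Poly_Mapping.keys p. Poly_Mapping.keys m \<subseteq> {..<n}}"
  let ?f = "\<Sum>m\<in>?K. cscale (Poly_Mapping.lookup p m) (monom_fun n (Poly_Mapping.lookup m))"
  have "?f \<in> poly_fun n"
    by (intro poly_fun_sum poly_fun_scale) (auto simp: poly_fun_def intro: fv.span_base)
  moreover have "ceval p z = ?f z" if z: "z \<in> aff n" for z
  proof -
    have "mon_eval m z = 0" if m: "\<not> Poly_Mapping.keys m \<subseteq> {..<n}" for m
    proof -
      obtain i where i: "i \<in> Poly_Mapping.keys m" "i \<ge> n" using m by (metis lessThan_iff not_less subsetI)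
      then have "z i = 0" using z by (auto simp: aff_def)
      then show ?thesis unfolding mon_eval_def using i
        by (intro prod_zero bexI[of _ i]) (auto simp: in_keys_iff)
    qed
    then have "ceval p z = (\<Sum>m\<in>?K. Poly_Mapping.lookup p m * mon_eval m z)"
      unfolding ceval_def by (intro sum.mono_neutral_right) auto
    also have "\<dots> = ?f z"
      unfolding sum_fun_apply by (rule sum.cong) (auto simp: mon_eval_eq_monom_fun[of _ n])
    finally show ?thesis .
  qed
  ultimately show ?thesis by blast
qed

text \<open>The passage from formal polynomials to polynomial functions; closed sets are handled
  only in this form afterwards.\<close>

lemma zariski_closed_iff:
  "zariski_closed n S \<longleftrightarrow> (\<exists>Q\<subseteq>poly_fun n. S = {z \<in> aff n. \<forall>f\<in>Q. f z = 0})"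
proof
  assume "zariski_closed n S"
  then obtain P where P: "S = {z \<in> aff n. \<forall>p\<in>P. ceval p z = 0}" by (auto simp: zariski_closed_def)
  obtain h where h: "\<And>p. h p \<in> poly_fun n" "\<And>p z. z \<in> aff n \<Longrightarrow> ceval p z = h p z"
    using ceval_eq_poly_fun by metis
  show "\<exists>Q\<subseteq>poly_fun n. S = {z \<in> aff n. \<forall>f\<in>Q. f z = 0}"
    by (rule exI[of _ "h ` P"]) (use h P in auto)
next
  assume "\<exists>Q\<subseteq>poly_fun n. S = {z \<in> aff n. \<forall>f\<in>Q. f z = 0}"
  then obtain Q where Q: "Q \<subseteq> poly_fun n" "S = {z \<in> aff n. \<forall>f\<in>Q. f z = 0}" by blast
  obtain h where h: "\<And>f. f \<in> poly_fun n \<Longrightarrow> ceval (h f) = f" using poly_fun_eq_ceval by metis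
  have "ceval (h f) = f" if "f \<in> Q" for f using Q h that by blast
  then have "S = {z \<in> aff n. \<forall>p\<in>h ` Q. ceval p z = 0}" using Q(2) by simp
  then show "zariski_closed n S" unfolding zariski_closed_def by blast
qed

lemma zariski_closed_zeros: "Q \<subseteq> poly_fun n \<Longrightarrow> zariski_closed n {z \<in> aff n. \<forall>f\<in>Q. f z = 0}"
  by (auto simp: zariski_closed_iff)

lemma zariski_closed_subset: "zariski_closed n S \<Longrightarrow> S \<subseteq> aff n"
  by (auto simp: zariski_closed_iff)

lemma zariski_closed_Int:
  assumes "zariski_closed n A" "zariski_closed n B" shows "zariski_closed n (A \<inter> B)"
proof -
  from assms obtain P Q where P: "P \<subseteq> poly_fun n" "A = {z \<in> aff n. \<forall>f\<in>P. f z = 0}"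
    and Q: "Q \<subseteq> poly_fun n" "B = {z \<in> aff n. \<forall>f\<in>Q. f z = 0}" by (auto simp: zariski_closed_iff)
  have "A \<inter> B = {z \<in> aff n. \<forall>f\<in>P \<union> Q. f z = 0}" using P Q by auto
  then show ?thesis using P Q zariski_closed_zeros[of "P \<union> Q"] by auto
qed

lemma zariski_closed_hypersurface: "f \<in> poly_fun n \<Longrightarrow> zariski_closed n {z \<in> aff n. f z = 0}"
  using zariski_closed_zeros[of "{f}"] by simp

lemma zariski_closed_Un:
  assumes "zariski_closed n A" "zariski_closed n B" shows "zariski_closed n (A \<union> B)"
proof -
  from assms obtain P Q where P: "P \<subseteq> poly_fun n" "A = {z \<in> aff n. \<forall>f\<in>P. f z = 0}"
    and Q: "Q \<subseteq> poly_fun n" "B = {z \<in> aff n. \<forall>f\<in>Q. f z = 0}" by (auto simp: zariski_closed_iff)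
  have eq: "A \<union> B = {z \<in> aff n. \<forall>f\<in>(\<lambda>(p, q). p * q) ` (P \<times> Q). f z = 0}" using P Q by auto
  have "(\<lambda>(p, q). p * q) ` (P \<times> Q) \<subseteq> poly_fun n"
    using P(1) Q(1) by (auto intro!: poly_fun_mult)
  from zariski_closed_zeros[OF this] show ?thesis unfolding eq .
qed

lemma zariski_closed_empty: "zariski_closed n {}"
  using zariski_closed_zeros[of "{1}" n] one_in_poly_fun by simp

lemma zariski_closed_Union:
  "finite \<A> \<Longrightarrow> (\<And>A. A \<in> \<A> \<Longrightarrow> zariski_closed n A) \<Longrightarrow> zariski_closed n (\<Union>\<A>)"
  by (induction \<A> rule: finite_induct) (auto intro: zariski_closed_empty zariski_closed_Un)

text \<open>This is the primality of the vanishing ideal of \<open>Z\<close>: the zero loci of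
  \<open>f\<close> and \<open>g\<close> in \<open>Z\<close> are closed and cover
  \<open>Z\<close>.\<close>

lemma zariski_irred_mult_zero:
  assumes Z: "zariski_irred n Z" and fg: "f \<in> poly_fun n" "g \<in> poly_fun n"
    and zero: "\<And>z. z \<in> Z \<Longrightarrow> f z * g z = 0"
  shows "(\<forall>z\<in>Z. f z = 0) \<or> (\<forall>z\<in>Z. g z = 0)"
proof -
  have cl: "zariski_closed n Z" using Z by (simp add: zariski_irred_def)
  let ?A = "Z \<inter> {z \<in> aff n. f z = 0}" and ?B = "Z \<inter> {z \<in> aff n. g z = 0}"
  have "Z = ?A \<union> ?B" using zero zariski_closed_subset[OF cl] by auto
  moreover have "zariski_closed n ?A" "zariski_closed n ?B"
    using cl fg by (auto intro!: zariski_closed_Int zariski_closed_hypersurface)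
  ultimately have "Z = ?A \<or> Z = ?B" using Z unfolding zariski_irred_def by blast
  then show ?thesis by blast
qed

lemma zariski_irred_subset_Union:
  assumes Z: "zariski_irred n Z" and "finite \<A>" "\<And>A. A \<in> \<A> \<Longrightarrow> zariski_closed n A" "Z \<subseteq> \<Union>\<A>"
  shows "\<exists>A\<in>\<A>. Z \<subseteq> A"
  using assms(2-)
proof (induction \<A> rule: finite_induct)
  case empty
  then show ?case using Z by (auto simp: zariski_irred_def)
next
  case (insert A \<A>)
  have cl: "zariski_closed n Z" using Z by (simp add: zariski_irred_def)
  have "zariski_closed n (Z \<inter> A)" "zariski_closed n (Z \<inter> \<Union>\<A>)"
    using insert cl by (auto intro!: zariski_closed_Int zariski_closed_Union)
  moreover have "Z = (Z \<inter> A) \<union> (Z \<inter> \<Union>\<A>)" using insert by auto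
  ultimately have "Z = Z \<inter> A \<or> Z = Z \<inter> \<Union>\<A>" using Z unfolding zariski_irred_def by blast
  then show ?case
  proof
    assume "Z = Z \<inter> \<Union>\<A>"
    then have "\<exists>A\<in>\<A>. Z \<subseteq> A" using insert by blast
    then show ?thesis by blast
  qed blast
qed

lemma zariski_irred_zero: "zariski_irred n {\<lambda>_. 0}"
proof -
  have eq: "{\<lambda>_. 0} = {z \<in> aff n. \<forall>f\<in>(\<lambda>i z. z i) ` {..<n}. f z = 0}"
  proof (intro subset_antisym subsetI)
    fix z assume "z \<in> {z \<in> aff n. \<forall>f\<in>(\<lambda>i z. z i) ` {..<n}. f z = 0}"
    then have "z i = 0" for i by (cases "i < n") (auto simp: aff_def)
    then show "z \<in> {\<lambda>_. 0}" by auto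
  qed (auto simp: aff_def)
  have "zariski_closed n {\<lambda>_. 0}"
    unfolding eq by (rule zariski_closed_zeros) (auto intro: var_in_poly_fun)
  moreover have irr: "zariski_irred n {x}" if "zariski_closed n {x}" for x
    using that unfolding zariski_irred_def by blast
  ultimately show ?thesis by (intro irr)
qed

subsection \<open>Growth of the Hilbert function\<close>

text \<open>The members of \<open>T\<close> may be arbitrary functions, since only their number
  enters a growth bound. This freedom admits indicator functions in unions and negative powers of
  coordinates on strata.\<close>

definition spanned_on :: "'a set \<Rightarrow> ('a \<Rightarrow> complex) set \<Rightarrow> ('a \<Rightarrow> complex) set" where
  "spanned_on V T = {f. \<exists>g\<in>fv.span T. \<forall>z\<in>V. f z = g z}"

text \<open>The Hilbert function at \<open>s\<close> is the dimension of the space of restrictions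
  to \<open>V\<close> of polynomials of degree at most \<open>s\<close>. Here it is bounded above
  through spanning sets, and in \<open>hilb_ge\<close> below through independent families, so that
  no quotient space occurs.\<close>

definition hilb_le :: "nat \<Rightarrow> (nat \<Rightarrow> complex) set \<Rightarrow> nat \<Rightarrow> bool" where
  "hilb_le n V e \<longleftrightarrow>
     (\<exists>C. \<forall>s. \<exists>T. finite T \<and> card T \<le> C * (s + 1) ^ e \<and> poly_fun_le n s \<subseteq> spanned_on V T)"

definition hilb_ge :: "nat \<Rightarrow> (nat \<Rightarrow> complex) set \<Rightarrow> nat \<Rightarrow> nat \<Rightarrow> bool" where
  "hilb_ge n V s N \<longleftrightarrow> (\<exists>\<phi>. (\<forall>i<N. \<phi> i \<in> poly_fun_le n s) \<and>
     (\<forall>a :: nat \<Rightarrow> complex. (\<forall>z\<in>V. (\<Sum>i<N. a i * \<phi> i z) = 0) \<longrightarrow> (\<forall>i<N. a i = 0)))"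

definition irred_chain :: "nat \<Rightarrow> (nat \<Rightarrow> complex) set \<Rightarrow> nat \<Rightarrow> (nat \<Rightarrow> (nat \<Rightarrow> complex) set) \<Rightarrow> bool" where
  "irred_chain n V k Z \<longleftrightarrow>
     (\<forall>i\<le>k. zariski_irred n (Z i) \<and> Z i \<subseteq> V) \<and> (\<forall>i<k. Z i \<subset> Z (Suc i))"

lemma subspace_spanned_on: "fv.subspace (spanned_on V T)"
  unfolding fv.subspace_def
proof (intro conjI ballI allI)
  show "0 \<in> spanned_on V T" unfolding spanned_on_def by (intro CollectI bexI[of _ 0] fv.span_zero) auto
next
  fix f g assume "f \<in> spanned_on V T" "g \<in> spanned_on V T"
  then obtain f' g' where "f' \<in> fv.span T" "g' \<in> fv.span T" "\<forall>z\<in>V. f z = f' z" "\<forall>z\<in>V. g z = g' z"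
    unfolding spanned_on_def by auto
  then show "f + g \<in> spanned_on V T" unfolding spanned_on_def
    by (intro CollectI bexI[of _ "f' + g'"] fv.span_add) auto
next
  fix c f assume "f \<in> spanned_on V T"
  then obtain f' where "f' \<in> fv.span T" "\<forall>z\<in>V. f z = f' z"
    unfolding spanned_on_def by auto
  then show "cscale c f \<in> spanned_on V T" unfolding spanned_on_def
    by (intro CollectI bexI[of _ "cscale c f'"] fv.span_scale) auto
qed

lemma spanned_on_cong:
  assumes "f \<in> spanned_on V T" "\<And>z. z \<in> V \<Longrightarrow> g z = f z"
  shows "g \<in> spanned_on V T"
  using assms unfolding spanned_on_def by auto

lemma spanned_on_anti_mono: "W \<subseteq> V \<Longrightarrow> spanned_on V T \<subseteq> spanned_on W T"
  unfolding spanned_on_def by blast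

lemma spanned_on_base: "t \<in> T \<Longrightarrow> t \<in> spanned_on V T"
  unfolding spanned_on_def by (auto intro: fv.span_base)

lemma poly_fun_le_spanned_onI:
  assumes "\<And>e. (\<Sum>i<n. e i) \<le> s \<Longrightarrow> monom_fun n e \<in> spanned_on V T"
  shows "poly_fun_le n s \<subseteq> spanned_on V T"
  unfolding poly_fun_le_def using assms by (intro fv.span_minimal subspace_spanned_on) auto

lemma hilb_leI:
  assumes "\<And>s. \<exists>T. finite T \<and> card T \<le> C * (s + 1) ^ e \<and> poly_fun_le n s \<subseteq> spanned_on V T"
  shows "hilb_le n V e"
  unfolding hilb_le_def using assms by blast

lemma hilb_ge_le_card:
  assumes ge: "hilb_ge n V s N" and T: "finite T" "poly_fun_le n s \<subseteq> spanned_on V T"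
  shows "N \<le> card T"
proof (rule ccontr)
  assume "\<not> N \<le> card T"
  then have lt: "card T < card {..<N}" by simp
  obtain \<phi> where \<phi>: "\<And>i. i < N \<Longrightarrow> \<phi> i \<in> poly_fun_le n s"
    and ind: "\<And>a. (\<forall>z\<in>V. (\<Sum>i<N. a i * \<phi> i z) = 0) \<Longrightarrow> (\<forall>i<N. a i = 0)"
    using ge unfolding hilb_ge_def by blast
  have "\<forall>i. \<exists>g. i < N \<longrightarrow> g \<in> fv.span T \<and> (\<forall>z\<in>V. \<phi> i z = g z)"
    using \<phi> T(2) unfolding spanned_on_def by blast
  from choice[OF this] obtain g
    where g: "\<And>i. i < N \<Longrightarrow> g i \<in> fv.span T" "\<And>i z. i < N \<Longrightarrow> z \<in> V \<Longrightarrow> \<phi> i z = g i z"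
    by auto
  obtain a where a: "\<exists>i\<in>{..<N}. a i \<noteq> 0" "(\<Sum>i<N. cscale (a i) (g i)) = 0"
    using ex_relation_of_span[OF T(1) _ lt, of g] g(1) by auto
  have "(\<Sum>i<N. a i * \<phi> i z) = 0" if "z \<in> V" for z
  proof -
    have "(\<Sum>i<N. a i * \<phi> i z) = (\<Sum>i<N. cscale (a i) (g i)) z"
      using g(2) that by (simp add: sum_fun_apply)
    then show ?thesis using a(2) by simp
  qed
  then show False using ind a(1) by auto
qed

lemma hilb_ge_mono: "hilb_ge n V s N \<Longrightarrow> s \<le> t \<Longrightarrow> hilb_ge n V t N"
  unfolding hilb_ge_def using poly_fun_le_mono[of s t n] by blast

lemma hilb_ge_one: 
  assumes "V \<noteq> {}" shows "hilb_ge n V s 1"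
  unfolding hilb_ge_def
proof (intro exI conjI allI impI)
  show "(1 :: (nat \<Rightarrow> complex) \<Rightarrow> complex) \<in> poly_fun_le n s" for i :: nat
    using one_in_poly_fun_le poly_fun_le_mono[of 0 s n] by blast
  fix a :: "nat \<Rightarrow> complex" and i :: nat
  assume "\<forall>z\<in>V. (\<Sum>i<1. a i * 1 z) = 0" "i < 1"
  then show "a i = 0" using assms by auto
qed

text \<open>The new family consists of the \<open>\<phi> i\<close> and the products
  \<open>f * \<psi> j\<close>. Restricting a relation on \<open>Z'\<close> to \<open>Z\<close>,
  where \<open>f\<close> vanishes, kills the coefficients of the \<open>\<phi> i\<close>; what
  remains is \<open>f\<close> times a combination of the \<open>\<psi> j\<close>, and irreducibility
  of \<open>Z'\<close> cancels \<open>f\<close>.\<close>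

lemma hilb_ge_step:
  assumes irr: "zariski_irred n Z'" and sub: "Z \<subseteq> Z'" and f: "f \<in> poly_fun_le n d"
    and f0: "\<And>z. z \<in> Z \<Longrightarrow> f z = 0" and f1: "z' \<in> Z'" "f z' \<noteq> 0"
    and N: "hilb_ge n Z s N" and M: "hilb_ge n Z' t M" and st: "t + d \<le> s"
  shows "hilb_ge n Z' s (N + M)"
proof -
  obtain \<phi> where \<phi>: "\<And>i. i < N \<Longrightarrow> \<phi> i \<in> poly_fun_le n s"
    and ind: "\<And>a. (\<forall>z\<in>Z. (\<Sum>i<N. a i * \<phi> i z) = 0) \<Longrightarrow> (\<forall>i<N. a i = 0)"
    using N unfolding hilb_ge_def by blast
  obtain \<psi> where \<psi>: "\<And>i. i < M \<Longrightarrow> \<psi> i \<in> poly_fun_le n t"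
    and ind': "\<And>a. (\<forall>z\<in>Z'. (\<Sum>i<M. a i * \<psi> i z) = 0) \<Longrightarrow> (\<forall>i<M. a i = 0)"
    using M unfolding hilb_ge_def by blast
  define \<theta> where "\<theta> i = (if i < N then \<phi> i else f * \<psi> (i - N))" for i
  have split: "(\<Sum>i<N+M. a i * \<theta> i z) = (\<Sum>i<N. a i * \<phi> i z) + f z * (\<Sum>i<M. a (N + i) * \<psi> i z)"
    for a :: "nat \<Rightarrow> complex" and z
  proof -
    have "(\<Sum>i<N+M. a i * \<theta> i z) = (\<Sum>i<N. a i * \<theta> i z) + (\<Sum>i<M. a (N + i) * \<theta> (N + i) z)"
      by (induction M) (auto simp: add.assoc)
    then show ?thesis by (simp add: \<theta>_def sum_distrib_left mult_ac)
  qed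
  show ?thesis unfolding hilb_ge_def
  proof (intro exI[of _ \<theta>] conjI allI impI)
    fix i assume i: "i < N + M"
    show "\<theta> i \<in> poly_fun_le n s"
    proof (cases "i < N")
      case False
      then have "f * \<psi> (i - N) \<in> poly_fun_le n (d + t)"
        using i by (intro poly_fun_le_mult f \<psi>) auto
      then show ?thesis using False st poly_fun_le_mono[of "d + t" s n] by (auto simp: \<theta>_def)
    qed (use \<phi> in \<open>auto simp: \<theta>_def\<close>)
  next
    fix a :: "nat \<Rightarrow> complex" and i
    assume a: "\<forall>z\<in>Z'. (\<Sum>i<N + M. a i * \<theta> i z) = 0" and i: "i < N + M"
    have "(\<Sum>i<N. a i * \<phi> i z) = 0" if "z \<in> Z" for z
    proof -
      have "(\<Sum>i<N + M. a i * \<theta> i z) = 0" using a sub that by blast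
      then show ?thesis using f0[OF that] unfolding split by simp
    qed
    then have 1: "\<forall>i<N. a i = 0" by (intro ind) blast
    let ?g = "\<Sum>i<M. cscale (a (N + i)) (\<psi> i)"
    have g: "?g \<in> poly_fun n"
      using \<psi> poly_fun_le_subset[of n t] by (intro poly_fun_sum poly_fun_scale) auto
    have ga: "?g z = (\<Sum>i<M. a (N + i) * \<psi> i z)" for z by (simp add: sum_fun_apply)
    have "(\<forall>z\<in>Z'. f z = 0) \<or> (\<forall>z\<in>Z'. ?g z = 0)"
    proof (rule zariski_irred_mult_zero[OF irr _ g])
      show "f \<in> poly_fun n" using f poly_fun_le_subset by blast
      show "f z * ?g z = 0" if "z \<in> Z'" for z
        using a that 1 unfolding split ga by auto
    qed
    then have "\<forall>z\<in>Z'. ?g z = 0" using f1 by auto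
    then have "\<forall>i<M. a (N + i) = 0" unfolding ga by (rule ind')
    then show "a i = 0" using 1 i by (cases "i < N") (auto dest: spec[of _ "i - N"] simp: not_less less_diff_conv2)
  qed
qed

lemma zariski_closed_separate:
  assumes "zariski_closed n Z" "zariski_closed n Z'" "Z \<subset> Z'"
  shows "\<exists>f\<in>poly_fun n. (\<forall>z\<in>Z. f z = 0) \<and> (\<exists>z\<in>Z'. f z \<noteq> 0)"
proof -
  obtain Q where Q: "Q \<subseteq> poly_fun n" "Z = {z \<in> aff n. \<forall>f\<in>Q. f z = 0}"
    using assms(1) by (auto simp: zariski_closed_iff)
  obtain z where z: "z \<in> Z'" "z \<notin> Z" using assms(3) by blast
  moreover have "z \<in> aff n" using z zariski_closed_subset[OF assms(2)] by blast
  ultimately obtain f where "f \<in> Q" "f z \<noteq> 0" unfolding Q(2) by blast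
  then show ?thesis using Q z by (intro bexI[of _ f]) auto
qed

text \<open>Multiplication by an equation of the smaller set embeds the functions on the larger set into
  those vanishing on the smaller one; iterating this recurrence is Pascal's rule.\<close>

lemma irred_chain_hilb_ge:
  assumes "\<And>i. i \<le> k \<Longrightarrow> zariski_irred n (Z i)" "\<And>i. i < k \<Longrightarrow> Z i \<subset> Z (Suc i)"
  shows "\<exists>D. \<forall>s. hilb_ge n (Z k) (D * s) ((s + k) choose k)"
  using assms
proof (induction k)
  case 0
  then have "Z 0 \<noteq> {}" by (auto simp: zariski_irred_def)
  then show ?case using hilb_ge_one[of "Z 0"] by auto
next
  case (Suc k)
  then obtain D where D: "\<And>s. hilb_ge n (Z k) (D * s) ((s + k) choose k)" by auto
  have irr: "zariski_irred n (Z (Suc k))" "zariski_irred n (Z k)" using Suc.prems by auto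
  have sub: "Z k \<subset> Z (Suc k)" using Suc.prems by auto
  obtain f where f: "f \<in> poly_fun n" "\<forall>z\<in>Z k. f z = 0" "\<exists>z\<in>Z (Suc k). f z \<noteq> 0"
    using zariski_closed_separate[of n "Z k" "Z (Suc k)"] irr sub by (auto simp: zariski_irred_def)
  then obtain z' where z': "z' \<in> Z (Suc k)" "f z' \<noteq> 0" by blast
  obtain d where d: "f \<in> poly_fun_le n d" by (rule poly_fun_obtain_deg[OF f(1)])
  \<comment> \<open>Raising \<open>s\<close> by one has to pay for the factor \<open>f\<close>, of
    degree at most \<open>d\<close>, and for the functions on \<open>Z k\<close>, of degree at most
    \<open>D * Suc s\<close>; the slope \<open>D + d\<close> covers both.\<close>
  have "hilb_ge n (Z (Suc k)) ((D + d) * s) ((s + Suc k) choose Suc k)" for s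
  proof (induction s)
    case 0
    then show ?case using hilb_ge_one[of "Z (Suc k)"] z' by auto
  next
    case (Suc s)
    have "hilb_ge n (Z k) ((D + d) * Suc s) ((Suc s + k) choose k)"
      by (rule hilb_ge_mono[OF D]) (auto simp: algebra_simps)
    then have "hilb_ge n (Z (Suc k)) ((D + d) * Suc s) (((Suc s + k) choose k) + ((s + Suc k) choose Suc k))"
      by (intro hilb_ge_step[OF irr(1) _ d _ z' _ Suc]) (use sub f(2) in auto)
    moreover have "((Suc s + k) choose k) + ((s + Suc k) choose Suc k) = (Suc s + Suc k) choose Suc k"
      by simp
    ultimately show ?case by (simp only:)
  qed
  then show ?case by blast
qed

text \<open>The right-hand side is the product (s+1)(s+2)...(s+k).\<close>

lemma power_le_fact_binomial: "(s + 1) ^ k \<le> fact k * ((s + k) choose k)"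
proof (induction k)
  case (Suc k)
  have "(s + 1) ^ Suc k \<le> (s + Suc k) * (fact k * ((s + k) choose k))"
    using mult_mono[of "s + 1" "s + Suc k", OF _ Suc] by simp
  also have "\<dots> = fact k * (Suc (s + k) * ((s + k) choose k))" by (simp add: algebra_simps)
  also have "\<dots> = fact (Suc k) * ((s + Suc k) choose Suc k)"
    unfolding Suc_times_binomial_eq by (simp add: algebra_simps)
  finally show ?case .
qed simp

text \<open>The chain yields order s^k many independent functions in degree \<open>D * s\<close>,
  while \<open>hilb_le\<close> allows only order s^e; the linear rescaling by \<open>D\<close>
  affects constants only.\<close>

lemma irred_chain_le_hilb:
  assumes Z: "irred_chain n V k Z" and e: "hilb_le n V e"
  shows "k \<le> e"
proof (rule ccontr)
  assume ke: "\<not> k \<le> e"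
  obtain D where D: "\<And>s. hilb_ge n (Z k) (D * s) ((s + k) choose k)"
    using irred_chain_hilb_ge[of k n Z] Z unfolding irred_chain_def by auto
  obtain C where C: "\<And>s. \<exists>T. finite T \<and> card T \<le> C * (s + 1) ^ e \<and> poly_fun_le n s \<subseteq> spanned_on V T"
    using e unfolding hilb_le_def by blast
  define K where "K = fact k * C * (D + 1) ^ e"
  have bound: "(s + 1) ^ k \<le> K * (s + 1) ^ e" for s
  proof -
    obtain T where T: "finite T" "card T \<le> C * (D * s + 1) ^ e" "poly_fun_le n (D * s) \<subseteq> spanned_on V T"
      using C[of "D * s"] by (elim exE conjE)
    have "spanned_on V T \<subseteq> spanned_on (Z k) T"
      using Z by (intro spanned_on_anti_mono) (simp add: irred_chain_def)
    then have "((s + k) choose k) \<le> card T"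
      using hilb_ge_le_card[OF D T(1)] T(3) by blast
    also note T(2)
    also have "C * (D * s + 1) ^ e \<le> C * ((D + 1) * (s + 1)) ^ e"
      by (intro mult_left_mono power_mono) (auto simp: algebra_simps)
    finally have "fact k * ((s + k) choose k) \<le> fact k * (C * ((D + 1) * (s + 1)) ^ e)"
      by (intro mult_left_mono) auto
    also have "\<dots> = K * (s + 1) ^ e" unfolding K_def power_mult_distrib by (simp only: mult.assoc)
    finally show ?thesis using power_le_fact_binomial[of s k] by (rule order_trans[rotated])
  qed
  \<comment> \<open>The choice s = K suffices: for k > e the power (K+1)^k is at least (K+1)(K+1)^e,
    which exceeds the bound K(K+1)^e.\<close>
  have "(K + 1) * (K + 1) ^ e \<le> (K + 1) ^ (k - e) * (K + 1) ^ e"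
    using ke by (intro mult_right_mono self_le_power) auto
  also have "\<dots> = (K + 1) ^ k" using ke by (simp flip: power_add)
  also note bound[of K]
  finally show False by simp
qed

lemma hilb_le_mono:
  assumes "hilb_le n V e" "W \<subseteq> V" "e \<le> e'"
  shows "hilb_le n W e'"
proof -
  obtain C where C: "\<And>s. \<exists>T. finite T \<and> card T \<le> C * (s + 1) ^ e \<and> poly_fun_le n s \<subseteq> spanned_on V T"
    using assms unfolding hilb_le_def by blast
  show ?thesis
  proof (rule hilb_leI[where C = C])
    fix s
    obtain T where T: "finite T" "card T \<le> C * (s + 1) ^ e" "poly_fun_le n s \<subseteq> spanned_on V T"
      using C[of s] by (elim exE conjE)
    have "C * (s + 1) ^ e \<le> C * (s + 1) ^ e'"
      using assms(3) by (intro mult_left_mono power_increasing) auto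
    with T(2) have "card T \<le> C * (s + 1) ^ e'" by (rule order_trans)
    then show "\<exists>T. finite T \<and> card T \<le> C * (s + 1) ^ e' \<and> poly_fun_le n s \<subseteq> spanned_on W T"
      using T spanned_on_anti_mono[OF assms(2), of T] by (intro exI[of _ T]) auto
  qed
qed

text \<open>If \<open>f\<close> agrees with \<open>g\<close> on \<open>V\<close> and with
  \<open>h\<close> on \<open>W\<close>, then on the union it is the indicator of \<open>V\<close>
  times \<open>g\<close> plus the indicator of \<open>W - V\<close> times \<open>h\<close>. The two
  spanning sets, multiplied by these indicators, are put together.\<close>

lemma hilb_le_Un:
  assumes "hilb_le n V e" "hilb_le n W e"
  shows "hilb_le n (V \<union> W) e"
proof -
  obtain C where C: "\<And>s. \<exists>T. finite T \<and> card T \<le> C * (s + 1) ^ e \<and> poly_fun_le n s \<subseteq> spanned_on V T"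
    using assms unfolding hilb_le_def by blast
  obtain C' where C': "\<And>s. \<exists>T. finite T \<and> card T \<le> C' * (s + 1) ^ e \<and> poly_fun_le n s \<subseteq> spanned_on W T"
    using assms unfolding hilb_le_def by blast
  have "\<exists>T. finite T \<and> card T \<le> (C + C') * (s + 1) ^ e \<and> poly_fun_le n s \<subseteq> spanned_on (V \<union> W) T" for s
  proof -
    obtain T where T: "finite T" "card T \<le> C * (s + 1) ^ e" "poly_fun_le n s \<subseteq> spanned_on V T"
      using C[of s] by auto
    obtain T' where T': "finite T'" "card T' \<le> C' * (s + 1) ^ e" "poly_fun_le n s \<subseteq> spanned_on W T'"
      using C'[of s] by auto
    define ind :: "(nat \<Rightarrow> complex) set \<Rightarrow> (nat \<Rightarrow> complex) \<Rightarrow> complex"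
      where "ind A = (\<lambda>z. if z \<in> A then 1 else 0)" for A
    define U where "U = (\<lambda>t. ind V * t) ` T \<union> (\<lambda>t. ind (W - V) * t) ` T'"
    have *: "ind A * g \<in> fv.span U" if "g \<in> fv.span S" "(\<lambda>t. ind A * t) ` S \<subseteq> U" for A g S
    proof (rule span_mult_mem[OF fv.subspace_span _ fv.span_base[of _ "{ind A}"] that(1)])
      show "x * y \<in> fv.span U" if "x \<in> {ind A}" "y \<in> S" for x y
        using that \<open>_ ` S \<subseteq> U\<close> by (auto intro: fv.span_base)
    qed simp
    have "card U \<le> card T + card T'" unfolding U_def
      by (meson add_mono card_Un_le card_image_le T(1) T'(1) order_trans)
    then have "card U \<le> (C + C') * (s + 1) ^ e" using T T' by (simp add: algebra_simps)
    moreover have "finite U" using T T' by (simp add: U_def)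
    moreover have "f \<in> spanned_on (V \<union> W) U" if f: "f \<in> poly_fun_le n s" for f
    proof -
      obtain g where g: "g \<in> fv.span T" "\<forall>z\<in>V. f z = g z"
        using T(3) f unfolding spanned_on_def by blast
      obtain h where h: "h \<in> fv.span T'" "\<forall>z\<in>W. f z = h z"
        using T'(3) f unfolding spanned_on_def by blast
      have "ind V * g + ind (W - V) * h \<in> fv.span U"
        by (intro fv.span_add *[OF g(1)] *[OF h(1)]) (auto simp: U_def)
      then show ?thesis unfolding spanned_on_def using g(2) h(2)
        by (intro CollectI bexI[of _ "ind V * g + ind (W - V) * h"]) (auto simp: ind_def)
    qed
    ultimately show ?thesis by blast
  qed
  then show ?thesis unfolding hilb_le_def by blast
qed

lemma hilb_le_UN:
  assumes "finite A" "\<And>a. a \<in> A \<Longrightarrow> hilb_le n (V a) e"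
  shows "hilb_le n (\<Union>a\<in>A. V a) e"
  using assms
proof (induction A rule: finite_induct)
  case empty
  have "poly_fun_le n s \<subseteq> spanned_on {} {}" for s by (auto simp: spanned_on_def)
  then show ?case by (intro hilb_leI[where C = 0] exI[of _ "{}"]) auto
next
  case (insert a A)
  then show ?case by (simp add: hilb_le_Un)
qed

text \<open>The monomials in the remaining variables with all exponents at most \<open>s\<close>
  span the restrictions. The case of empty \<open>J\<close> also gives the general bound
  \<open>n\<close> and the finite dimension of \<open>poly_fun_le n s\<close>.\<close>

lemma hilb_le_coordinate_subspace:
  assumes J: "J \<subseteq> {..<n}"
  shows "hilb_le n {z. \<forall>j\<in>J. z j = 0} (n - card J)"
proof (rule hilb_leI[where C = 1])
  fix s
  let ?I = "{..<n} - J" and ?V = "{z :: nat \<Rightarrow> complex. \<forall>j\<in>J. z j = 0}"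
  \<comment> \<open>Members of the extensional function space are \<open>undefined\<close> outside
    \<open>?I\<close>; \<open>ext\<close> puts the exponent 0 there.\<close>
  define ext where "ext e i = (if i \<in> ?I then e i else 0)" for e :: "nat \<Rightarrow> nat" and i
  define T where "T = (\<lambda>e. monom_fun n (ext e)) ` (?I \<rightarrow>\<^sub>E {..s})"
  have fin: "finite (?I \<rightarrow>\<^sub>E {..s})" by (intro finite_PiE) auto
  have cI: "card ?I = n - card J" using J by (simp add: card_Diff_subset finite_subset)
  have "card T \<le> card (?I \<rightarrow>\<^sub>E {..s})" unfolding T_def by (rule card_image_le[OF fin])
  also have "\<dots> = (s + 1) ^ (n - card J)" by (simp add: card_PiE cI)
  finally have "card T \<le> 1 * (s + 1) ^ (n - card J)" by simp
  moreover have "poly_fun_le n s \<subseteq> spanned_on ?V T"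
  proof (rule poly_fun_le_spanned_onI)
    fix e :: "nat \<Rightarrow> nat" assume e: "(\<Sum>i<n. e i) \<le> s"
    show "monom_fun n e \<in> spanned_on ?V T"
    proof (cases "\<exists>j\<in>J. e j > 0")
      case True
      then obtain j where j: "j \<in> J" "e j > 0" by blast
      have "monom_fun n e z = 0" if "z \<in> ?V" for z
        unfolding monom_fun_def using that j J by (intro prod_zero bexI[of _ j]) auto
      then show ?thesis by (intro spanned_on_cong[OF fv.subspace_0[OF subspace_spanned_on]]) auto
    next
      case False
      have le: "e i \<le> s" if "i < n" for i
        using member_le_sum[of i "{..<n}" e] that e by auto
      have "monom_fun n e = monom_fun n (ext (restrict e ?I))"
        by (rule monom_fun_cong) (use False in \<open>auto simp: ext_def\<close>)
      moreover have "restrict e ?I \<in> ?I \<rightarrow>\<^sub>E {..s}" using le by auto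
      ultimately have "monom_fun n e \<in> T" unfolding T_def by blast
      then show ?thesis by (rule spanned_on_base)
    qed
  qed
  ultimately show "\<exists>T. finite T \<and> card T \<le> 1 * (s + 1) ^ (n - card J) \<and> poly_fun_le n s \<subseteq> spanned_on ?V T"
    using fin unfolding T_def by blast
qed

section \<open>Krull dimension compared with growth\<close>

lemma var_dim_eq: "var_dim n V = Sup {k. \<exists>Z. irred_chain n V k Z}"
  by (simp add: var_dim_def irred_chain_def)

text \<open>A supremum of naturals bounds its members only if they are bounded; growth of order at
  most \<open>n\<close> on any set bounds all chain lengths by \<open>n\<close>.\<close>

lemma irred_chain_le_var_dim:
  assumes "irred_chain n V k Z" shows "k \<le> var_dim n V"
proof -
  have "hilb_le n V n" 
    using hilb_le_coordinate_subspace[of "{}" n] by (auto intro: hilb_le_mono)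
  then have "\<forall>k\<in>{k. \<exists>Z. irred_chain n V k Z}. k \<le> n" using irred_chain_le_hilb by blast
  then show ?thesis unfolding var_dim_eq using assms by (intro cSup_upper) (auto simp: bdd_above_def)
qed

lemma var_dim_le_hilb:
  assumes "hilb_le n V e" shows "var_dim n V \<le> e"
proof (cases "{k. \<exists>Z. irred_chain n V k Z} = {}")
  \<comment> \<open>Without irreducible closed subsets the supremum runs over the empty set and
    equals 0.\<close>
  case True
  then show ?thesis unfolding var_dim_eq by (simp only: Sup_nat_empty le0)
next
  case False
  then show ?thesis unfolding var_dim_eq using assms irred_chain_le_hilb by (intro cSup_least) auto
qed

subsection \<open>Nullstellensatz\<close>

definition poly_ideal :: "nat \<Rightarrow> ((nat \<Rightarrow> complex) \<Rightarrow> complex) set \<Rightarrow> bool" where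
  "poly_ideal n I \<longleftrightarrow> I \<subseteq> poly_fun n \<and> 0 \<in> I \<and> (\<forall>f\<in>I. \<forall>g\<in>I. f + g \<in> I) \<and>
     (\<forall>f\<in>I. \<forall>g\<in>poly_fun n. g * f \<in> I)"

definition ideal_adjoin ::
  "nat \<Rightarrow> ((nat \<Rightarrow> complex) \<Rightarrow> complex) set \<Rightarrow> ((nat \<Rightarrow> complex) \<Rightarrow> complex) \<Rightarrow> ((nat \<Rightarrow> complex) \<Rightarrow> complex) set"
  where "ideal_adjoin n I g = {a + b * g | a b. a \<in> I \<and> b \<in> poly_fun n}"

lemma poly_idealD:
  assumes "poly_ideal n I"
  shows "I \<subseteq> poly_fun n" "0 \<in> I" "\<And>f g. f \<in> I \<Longrightarrow> g \<in> I \<Longrightarrow> f + g \<in> I"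
    "\<And>f g. f \<in> I \<Longrightarrow> g \<in> poly_fun n \<Longrightarrow> g * f \<in> I"
  using assms unfolding poly_ideal_def by auto

lemma poly_ideal_scale: 
  assumes "poly_ideal n I" "f \<in> I" shows "cscale c f \<in> I"
  unfolding cscale_eq_mult by (rule poly_idealD(4)[OF assms const_in_poly_fun])

lemma poly_ideal_subspace: "poly_ideal n I \<Longrightarrow> fv.subspace I"
  unfolding fv.subspace_def by (intro conjI ballI allI poly_idealD(2,3) poly_ideal_scale)

lemma poly_ideal_diff: "poly_ideal n I \<Longrightarrow> f \<in> I \<Longrightarrow> g \<in> I \<Longrightarrow> f - g \<in> I"
  using fv.subspace_diff[OF poly_ideal_subspace] .

lemma poly_ideal_adjoin:
  assumes I: "poly_ideal n I" and g: "g \<in> poly_fun n"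
  shows "poly_ideal n (ideal_adjoin n I g)"
  unfolding poly_ideal_def
proof (intro conjI ballI subsetI)
  fix f assume "f \<in> ideal_adjoin n I g"
  then show "f \<in> poly_fun n" using poly_idealD(1)[OF I] g
    by (auto simp: ideal_adjoin_def intro!: poly_fun_add poly_fun_mult)
next
  show "0 \<in> ideal_adjoin n I g" unfolding ideal_adjoin_def
    using poly_idealD(2)[OF I] zero_in_poly_fun by (intro CollectI exI[of _ 0]) auto
next
  fix f h assume "f \<in> ideal_adjoin n I g" "h \<in> ideal_adjoin n I g"
  then obtain a b a' b' where "f = a + b * g" "h = a' + b' * g" "a \<in> I" "a' \<in> I"
    "b \<in> poly_fun n" "b' \<in> poly_fun n" unfolding ideal_adjoin_def by auto
  then show "f + h \<in> ideal_adjoin n I g" unfolding ideal_adjoin_def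
    using poly_idealD(3)[OF I] poly_fun_add
    by (intro CollectI exI[of _ "a + a'"] exI[of _ "b + b'"]) (simp add: algebra_simps)
next
  fix f h assume "f \<in> ideal_adjoin n I g" "h \<in> poly_fun n"
  then obtain a b where "f = a + b * g" "a \<in> I" "b \<in> poly_fun n" "h \<in> poly_fun n"
    unfolding ideal_adjoin_def by auto
  then show "h * f \<in> ideal_adjoin n I g" unfolding ideal_adjoin_def
    using poly_idealD(4)[OF I] poly_fun_mult
    by (intro CollectI exI[of _ "h * a"] exI[of _ "h * b"]) (simp add: algebra_simps)
qed

lemma ideal_adjoin_superset: "I \<subseteq> ideal_adjoin n I g"
proof
  fix f assume "f \<in> I"
  then show "f \<in> ideal_adjoin n I g" unfolding ideal_adjoin_def
    using zero_in_poly_fun[of n] by (intro CollectI exI[of _ f] exI[of _ 0]) simp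
qed

lemma ideal_adjoin_self: "poly_ideal n I \<Longrightarrow> g \<in> ideal_adjoin n I g"
  unfolding ideal_adjoin_def
  using one_in_poly_fun[of n] poly_idealD(2)[of n I] by (intro CollectI exI[of _ 0] exI[of _ 1]) simp

lemma poly_compose_var_in_poly_fun:
  assumes "i < n" shows "(\<lambda>z. poly q (z i)) \<in> poly_fun n"
proof -
  have "(\<lambda>z. poly q (z i)) = (\<Sum>k\<le>degree q. cscale (coeff q k) ((\<lambda>z. z i) ^ k))"
    by (auto simp: fun_eq_iff sum_fun_apply power_fun_apply poly_altdef)
  also have "\<dots> \<in> poly_fun n"
    by (intro poly_fun_sum poly_fun_scale poly_fun_power var_in_poly_fun assms)
  finally show ?thesis .
qed

lemma var_diff_const_in_poly_fun: "i < n \<Longrightarrow> (\<lambda>z. z i - c) \<in> poly_fun n"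
  using poly_compose_var_in_poly_fun[of i n "[:- c, 1:]"] by simp

text \<open>Every \<open>z i - c\<close> is invertible modulo \<open>I\<close>, with inverse
  \<open>p c\<close>. Over the complex numbers \<open>q\<close> has a root as long as it is not
  constant, so its linear factors can be cancelled one after another until a nonzero constant is
  left in \<open>I\<close>.\<close>

lemma univariate_in_ideal:
  assumes I: "poly_ideal n I" and i: "i < n"
    and inv: "\<And>c. p c \<in> poly_fun n" "\<And>c. p c * (\<lambda>z. z i - c) - 1 \<in> I"
  shows "q \<noteq> 0 \<Longrightarrow> (\<lambda>z. poly q (z i)) \<in> I \<Longrightarrow> 1 \<in> I"
proof (induction "degree q" arbitrary: q)
  case 0
  obtain c where c: "q = [:c:]" using degree_eq_zeroE[OF 0(1)[symmetric]] .
  with 0(2) have "c \<noteq> 0" by auto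
  have "cscale (1 / c) (\<lambda>z. poly q (z i)) \<in> I" by (rule poly_ideal_scale[OF I 0(3)])
  also have "cscale (1 / c) (\<lambda>z. poly q (z i)) = 1" using c \<open>c \<noteq> 0\<close> by (simp add: fun_eq_iff)
  finally show ?case .
next
  case (Suc k)
  from Suc.hyps(2) have "\<not> constant (poly q)" by (simp add: constant_degree)
  then obtain r where "poly q r = 0" using fundamental_theorem_of_algebra by blast
  then obtain q' where q': "q = [:- r, 1:] * q'" by (auto simp: poly_eq_0_iff_dvd)
  let ?f = "\<lambda>z. poly q (z i)" and ?f' = "\<lambda>z. poly q' (z i)"
  have "q' \<noteq> 0" using Suc.prems(1) q' by auto
  have "degree q = degree [:- r, 1:] + degree q'"
    unfolding q' by (rule degree_mult_eq) (use \<open>q' \<noteq> 0\<close> in auto)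
  then have "k = degree q'" using Suc.hyps(2) by simp
  have "p r * ?f - ?f' * (p r * (\<lambda>z. z i - r) - 1) \<in> I"
    by (rule poly_ideal_diff[OF I poly_idealD(4)[OF I Suc.prems(2) inv(1)]
          poly_idealD(4)[OF I inv(2) poly_compose_var_in_poly_fun[OF i]]])
  also have "p r * ?f - ?f' * (p r * (\<lambda>z. z i - r) - 1) = ?f'"
    by (simp add: q' fun_eq_iff algebra_simps)
  finally show ?case by (rule Suc.hyps(1)[OF \<open>k = degree q'\<close> \<open>q' \<noteq> 0\<close>])
qed

text \<open>The field of complex numbers is uncountable while the polynomial ring has countable
  dimension, so inverses of all the \<open>x\<^sub>i - c\<close> modulo the ideal satisfy a linear relation; clearing
  denominators yields a univariate polynomial in the ideal.\<close>

lemma ex_proper_adjoin_var: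
  assumes I: "poly_ideal n I" and proper: "1 \<notin> I" and i: "i < n"
  shows "\<exists>c. 1 \<notin> ideal_adjoin n I (\<lambda>z. z i - c)"
proof (rule ccontr)
  assume contra: "\<nexists>c. 1 \<notin> ideal_adjoin n I (\<lambda>z. z i - c)"
  have "\<exists>p\<in>poly_fun n. p * (\<lambda>z. z i - c) - 1 \<in> I" for c
  proof -
    have "1 \<in> ideal_adjoin n I (\<lambda>z. z i - c)" using contra by blast
    then obtain a b where ab: "1 = a + b * (\<lambda>z. z i - c)" "a \<in> I" "b \<in> poly_fun n"
      unfolding ideal_adjoin_def by (elim CollectE exE conjE)
    have eq: "b * (\<lambda>z. z i - c) - 1 = cscale (- 1) a"
      unfolding ab(1) by (auto simp: fun_eq_iff)
    show ?thesis
      by (rule bexI[of _ b, OF _ ab(3)]) (rule poly_ideal_scale[OF I ab(2), of "- 1", folded eq])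
  qed
  then have "\<forall>c. \<exists>p. p \<in> poly_fun n \<and> p * (\<lambda>z. z i - c) - 1 \<in> I" by (simp only: Bex_def) simp
  from choice[OF this] obtain p where
    "\<forall>c. p c \<in> poly_fun n \<and> p c * (\<lambda>z. z i - c) - 1 \<in> I" by (elim exE)
  then have p: "\<And>c. p c \<in> poly_fun n" "\<And>c. p c * (\<lambda>z. z i - c) - 1 \<in> I" by simp_all
  have "\<exists>s. p c \<in> poly_fun_le n s" for c
    by (rule poly_fun_obtain_deg[OF p(1)[of c]]) (rule exI)
  then have "\<forall>c. \<exists>s. p c \<in> poly_fun_le n s" by (rule allI)
  from choice[OF this] obtain dg where dg: "\<And>c. p c \<in> poly_fun_le n (dg c)" by auto
  \<comment> \<open>There are uncountably many \<open>c\<close> but only countably many degree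
    bounds, so infinitely many inverses share one bound \<open>s\<close> and lie in a
    finite-dimensional space.\<close>
  have "\<exists>s. infinite {c. dg c = s}"
  proof (rule ccontr)
    assume "\<nexists>s. infinite {c. dg c = s}"
    then have "countable (\<Union>s. {c. dg c = s})" by (intro countable_UN) (auto intro: countable_finite)
    moreover have "(\<Union>s. {c. dg c = s}) = UNIV" by auto
    ultimately show False using uncountable_UNIV_complex by simp
  qed
  then obtain s where s: "infinite {c. dg c = s}" by blast
  obtain T where T: "finite T" "poly_fun_le n s \<subseteq> spanned_on UNIV T"
    using hilb_le_coordinate_subspace[of "{}" n] unfolding hilb_le_def by auto
  have spanT: "spanned_on UNIV T = fv.span T"
    by (auto simp: spanned_on_def fun_eq_iff[symmetric])
  obtain S where S: "S \<subseteq> {c. dg c = s}" "finite S" "card S = Suc (card T)"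
    using infinite_arbitrarily_large[OF s] by blast
  have "p c \<in> fv.span T" if "c \<in> S" for c
    using dg[of c] that S(1) T(2) spanT by auto
  then obtain a where a: "\<exists>c\<in>S. a c \<noteq> 0" "(\<Sum>c\<in>S. cscale (a c) (p c)) = 0"
    using ex_relation_of_span[OF T(1) S(2), of p] S(3) by auto
  \<comment> \<open>\<open>R c\<close> vanishes at all points of \<open>S\<close> except
    \<open>c\<close>, as in Lagrange interpolation. Hence \<open>q\<close> takes the value
    \<open>a c0 * poly (R c0) c0\<close> at \<open>c0\<close>, which is nonzero.\<close>
  define R where "R c = (\<Prod>c'\<in>S - {c}. [:- c', 1:])" for c
  define q where "q = (\<Sum>c\<in>S. smult (a c) (R c))"
  obtain c0 where c0: "c0 \<in> S" "a c0 \<noteq> 0" using a by blast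
  have "poly (R c) c0 = 0" if "c \<in> S" "c \<noteq> c0" for c
    unfolding R_def poly_prod using that c0 S(2) by (intro prod_zero bexI[of _ c0]) auto
  then have "poly q c0 = (\<Sum>c\<in>S. if c = c0 then a c0 * poly (R c0) c0 else 0)"
    unfolding q_def poly_sum by (intro sum.cong) auto
  also have "\<dots> = a c0 * poly (R c0) c0" using c0 S(2) by simp
  also have "\<dots> \<noteq> 0" using c0 S(2) by (auto simp: R_def poly_prod)
  finally have "q \<noteq> 0" by auto
  \<comment> \<open>With P the product of all \<open>z i - c'\<close> over \<open>S\<close>, each P
    times \<open>p c\<close> is \<open>R c\<close> times \<open>p c\<close> times
    \<open>z i - c\<close>, hence congruent to \<open>R c\<close> modulo \<open>I\<close>.
    Multiplying the relation among the \<open>p c\<close> by P therefore puts \<open>q\<close>,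
    evaluated at the coordinate \<open>z i\<close>, into \<open>I\<close>.\<close>
  moreover have "(\<lambda>z. poly q (z i)) =
    cscale (- 1) (\<Sum>c\<in>S. cscale (a c) ((\<lambda>z. poly (R c) (z i)) * (p c * (\<lambda>z. z i - c) - 1)))"
  proof
    fix z
    define P where "P = (\<Prod>c'\<in>S. z i - c')"
    have P: "poly (R c) (z i) * (z i - c) = P" if "c \<in> S" for c
      unfolding P_def R_def poly_prod using that S(2) by (simp add: prod.remove[of S c] mult.commute)
    have rel: "(\<Sum>c\<in>S. a c * p c z) = 0"
      using fun_cong[OF a(2), of z] by (simp add: sum_fun_apply)
    have "(\<Sum>c\<in>S. a c * (poly (R c) (z i) * (p c z * (z i - c) - 1))) =
        (\<Sum>c\<in>S. P * (a c * p c z) - a c * poly (R c) (z i))"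
      by (intro sum.cong refl) (simp add: P[symmetric] algebra_simps)
    also have "\<dots> = - poly q (z i)"
      by (simp add: sum_subtractf sum_distrib_left[symmetric] rel q_def poly_sum)
    finally show "poly q (z i) = cscale (- 1) (\<Sum>c\<in>S. cscale (a c)
        ((\<lambda>z. poly (R c) (z i)) * (p c * (\<lambda>z. z i - c) - 1))) z"
      by (simp add: sum_fun_apply)
  qed
  moreover have "cscale (- 1) (\<Sum>c\<in>S. cscale (a c)
      ((\<lambda>z. poly (R c) (z i)) * (p c * (\<lambda>z. z i - c) - 1))) \<in> I"
    using poly_idealD(4)[OF I p(2) poly_compose_var_in_poly_fun[OF i]]
    by (intro poly_ideal_scale[OF I] fv.subspace_sum[OF poly_ideal_subspace[OF I]])
  ultimately have "1 \<in> I" using univariate_in_ideal[OF I i p] by simp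
  then show False using proper by blast
qed

text \<open>Adjoining some \<open>z i - c i\<close> for one variable at a time keeps the ideal
  proper. In the final ideal every polynomial is congruent to its value at the point
  \<open>w\<close> thus found, so a member of \<open>I\<close> with nonzero value at
  \<open>w\<close> would put 1 into it.\<close>

lemma weak_nullstellensatz:
  assumes I: "poly_ideal n I" and proper: "1 \<notin> I"
  shows "\<exists>z\<in>aff n. \<forall>f\<in>I. f z = 0"
proof -
  have "m \<le> n \<Longrightarrow> \<exists>I' c. poly_ideal n I' \<and> I \<subseteq> I' \<and> 1 \<notin> I' \<and> (\<forall>i<m. (\<lambda>z. z i - c i) \<in> I')" for m
  proof (induction m)
    case 0
    then show ?case using I proper by blast
  next
    case (Suc m)
    from Suc.IH[OF Suc_leD[OF Suc.prems]] obtain I' c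
      where I': "poly_ideal n I'" "I \<subseteq> I'" "1 \<notin> I'" "\<forall>i<m. (\<lambda>z. z i - c i) \<in> I'"
      by (elim exE conjE)
    have "m < n" using Suc.prems by simp
    from ex_proper_adjoin_var[OF I'(1,3) this] obtain r
      where r: "1 \<notin> ideal_adjoin n I' (\<lambda>z. z m - r)" by (elim exE)
    let ?J = "ideal_adjoin n I' (\<lambda>z. z m - r)"
    have "(\<lambda>z. z i - (c(m := r)) i) \<in> ?J" if "i < Suc m" for i
    proof (cases "i = m")
      case True
      then show ?thesis using ideal_adjoin_self[OF I'(1)] by simp
    next
      case False
      then have "(\<lambda>z. z i - c i) \<in> I'" using I'(4) that by auto
      then show ?thesis using False ideal_adjoin_superset[of I' n] by auto
    qed
    moreover have "poly_ideal n ?J"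
      using Suc.prems by (intro poly_ideal_adjoin I' var_diff_const_in_poly_fun) auto
    moreover have "I \<subseteq> ?J" using I'(2) ideal_adjoin_superset[of I' n] by blast
    ultimately show ?case using r by blast
  qed
  from this[of n] obtain I' c where I': "poly_ideal n I'" "I \<subseteq> I'" "1 \<notin> I'"
    and c: "\<And>i. i < n \<Longrightarrow> (\<lambda>z. z i - c i) \<in> I'" by auto
  define w where "w i = (if i < n then c i else 0)" for i
  have key: "f - (\<lambda>_. f w) \<in> I'" if f: "f \<in> poly_fun n" for f
  proof (rule poly_fun_induct[OF f, of "\<lambda>f. f - (\<lambda>_. f w) \<in> I'"])
    fix r :: complex
    have "(\<lambda>_. r) - (\<lambda>_. r) = (0 :: (nat \<Rightarrow> complex) \<Rightarrow> complex)" by auto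
    then show "(\<lambda>_. r) - (\<lambda>_. r) \<in> I'" using poly_idealD(2)[OF I'(1)] by simp
  next
    fix i assume i: "i < n"
    have "(\<lambda>z. z i) - (\<lambda>_. w i) = (\<lambda>z. z i - c i)" using i by (auto simp: w_def)
    then show "(\<lambda>z. z i) - (\<lambda>_. w i) \<in> I'" using c[OF i] by simp
  next
    fix f g assume "f - (\<lambda>_. f w) \<in> I'" "g - (\<lambda>_. g w) \<in> I'"
    then have "(f - (\<lambda>_. f w)) + (g - (\<lambda>_. g w)) \<in> I'" by (rule poly_idealD(3)[OF I'(1)])
    also have "(f - (\<lambda>_. f w)) + (g - (\<lambda>_. g w)) = f + g - (\<lambda>_. (f + g) w)" by (auto simp: fun_eq_iff)
    finally show "f + g - (\<lambda>_. (f + g) w) \<in> I'" .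
  next
    fix f g assume f: "f \<in> poly_fun n" and "f - (\<lambda>_. f w) \<in> I'" "g - (\<lambda>_. g w) \<in> I'"
    then have "f * (g - (\<lambda>_. g w)) + cscale (g w) (f - (\<lambda>_. f w)) \<in> I'"
      by (intro poly_idealD(3,4)[OF I'(1)] poly_ideal_scale[OF I'(1)])
    also have "f * (g - (\<lambda>_. g w)) + cscale (g w) (f - (\<lambda>_. f w)) = f * g - (\<lambda>_. (f * g) w)"
      by (auto simp: fun_eq_iff algebra_simps)
    finally show "f * g - (\<lambda>_. (f * g) w) \<in> I'" .
  qed
  have "f w = 0" if f: "f \<in> I" for f
  proof (rule ccontr)
    assume ne: "f w \<noteq> 0"
    have "f \<in> I'" "f \<in> poly_fun n" using f I'(2) poly_idealD(1)[OF I] by blast+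
    then have "f - (f - (\<lambda>_. f w)) \<in> I'" by (intro poly_ideal_diff[OF I'(1)] key)
    then have "cscale (1 / f w) (f - (f - (\<lambda>_. f w))) \<in> I'" by (rule poly_ideal_scale[OF I'(1)])
    also have "cscale (1 / f w) (f - (f - (\<lambda>_. f w))) = 1" using ne by (auto simp: fun_eq_iff)
    finally show False by (rule notE[OF I'(3)])
  qed
  moreover have "w \<in> aff n" by (auto simp: aff_def w_def)
  ultimately show ?thesis by blast
qed

subsection \<open>Cones cut out by forms\<close>

text \<open>The scalar 0 is included, so every nonempty cone contains the origin.\<close>

definition is_cone :: "(nat \<Rightarrow> complex) set \<Rightarrow> bool" where
  "is_cone W \<longleftrightarrow> (\<forall>z\<in>W. \<forall>c. (\<lambda>k. c * z k) \<in> W)"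

definition homogeneous :: "nat \<Rightarrow> ((nat \<Rightarrow> complex) \<Rightarrow> complex) \<Rightarrow> bool" where
  "homogeneous d f \<longleftrightarrow> (\<forall>c z. f (\<lambda>k. c * z k) = c ^ d * f z)"

text \<open>Multiplying by \<open>z i ^ N\<close> clears the denominators of \<open>b\<close> at the
  point z / z_i once \<open>N\<close> reaches the degree. Asking for all large \<open>N\<close> lets
  the summands of \<open>b\<close> use a common exponent.\<close>

lemma poly_fun_homogenize:
  assumes b: "b \<in> poly_fun n" and i: "i < n"
  shows "\<exists>D. \<forall>N\<ge>D. \<exists>b'\<in>poly_fun_le n N. \<forall>z. z i \<noteq> 0 \<longrightarrow> b' z = z i ^ N * b (\<lambda>k. inverse (z i) * z k)"
proof -
  define H where "H b N b' \<longleftrightarrow> b' \<in> poly_fun_le n N \<and>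
    (\<forall>z. z i \<noteq> 0 \<longrightarrow> b' z = z i ^ N * b (\<lambda>k. inverse (z i) * z k))" for b N b'
  define G where "G = {b. \<exists>D. \<forall>N\<ge>D. \<exists>b'. H b N b'}"
  have "poly_fun n \<subseteq> G" unfolding poly_fun_def
  proof (rule fv.span_minimal)
    show "range (monom_fun n) \<subseteq> G"
    proof
      fix f assume "f \<in> range (monom_fun n)"
      then obtain e where f: "f = monom_fun n e" by blast
      let ?D = "\<Sum>k<n. e k"
      have "H f N ((\<lambda>z. z i ^ (N - ?D)) * monom_fun n e)" if N: "N \<ge> ?D" for N
        unfolding H_def
      proof (intro conjI allI impI)
        have "monom_fun n e \<in> poly_fun_le n ?D"
          unfolding poly_fun_le_def by (intro fv.span_base) auto
        from poly_fun_le_mult[OF var_power_in_poly_fun_le[OF i, of "N - ?D"] this] N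
        show "(\<lambda>z. z i ^ (N - ?D)) * monom_fun n e \<in> poly_fun_le n N" by simp
        fix z :: "nat \<Rightarrow> complex" assume z: "z i \<noteq> 0"
        have "z i ^ N * inverse (z i) ^ ?D = z i ^ (N - ?D)"
          using z N by (simp add: power_diff power_inverse divide_inverse)
        then show "((\<lambda>z. z i ^ (N - ?D)) * monom_fun n e) z = z i ^ N * f (\<lambda>k. inverse (z i) * z k)"
          unfolding f monom_fun_homogeneous by (simp flip: mult.assoc)
      qed
      then show "f \<in> G" unfolding G_def by blast
    qed
    show "fv.subspace G" unfolding fv.subspace_def
    proof (intro conjI ballI allI)
      have "H 0 N 0" for N
        unfolding H_def using fv.subspace_0[OF subspace_poly_fun_le] by simp
      then show "0 \<in> G" unfolding G_def by blast
    next
      fix f g assume "f \<in> G" "g \<in> G"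
      then obtain D E where D: "\<And>N. N \<ge> D \<Longrightarrow> \<exists>b'. H f N b'" and E: "\<And>N. N \<ge> E \<Longrightarrow> \<exists>b'. H g N b'"
        unfolding G_def by blast
      have "\<exists>b'. H (f + g) N b'" if "N \<ge> max D E" for N
      proof -
        from that have "D \<le> N" "E \<le> N" by simp_all
        then obtain b' b'' where "H f N b'" "H g N b''" using D[of N] E[of N] by (elim meta_impE exE)
        then have "H (f + g) N (b' + b'')" unfolding H_def
          by (auto intro: fv.subspace_add[OF subspace_poly_fun_le] simp: algebra_simps)
        then show ?thesis by blast
      qed
      then show "f + g \<in> G" unfolding G_def by blast
    next
      fix c f assume "f \<in> G"
      then obtain D where D: "\<And>N. N \<ge> D \<Longrightarrow> \<exists>b'. H f N b'" unfolding G_def by blast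
      have "\<exists>b'. H (cscale c f) N b'" if N: "N \<ge> D" for N
      proof -
        obtain b' where "H f N b'" using D[OF N] by (elim exE)
        then have "H (cscale c f) N (cscale c b')" unfolding H_def
          by (auto intro: fv.subspace_scale[OF subspace_poly_fun_le] simp: algebra_simps)
        then show ?thesis by blast
      qed
      then show "cscale c f \<in> G" unfolding G_def by blast
    qed
  qed
  then obtain D where D: "\<And>N. N \<ge> D \<Longrightarrow> \<exists>b'. H b N b'" using b unfolding G_def by blast
  then show ?thesis unfolding H_def by (intro exI[of _ D]) auto
qed

section \<open>Finiteness of a cone over forms that vanish together only at the origin\<close>

context
  fixes n :: nat and W :: "(nat \<Rightarrow> complex) set" and A :: "'i set"
    and g :: "'i \<Rightarrow> (nat \<Rightarrow> complex) \<Rightarrow> complex" and d :: "'i \<Rightarrow> nat"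
  assumes W: "zariski_closed n W" "is_cone W" and A: "finite A"
    and g: "\<And>l. l \<in> A \<Longrightarrow> g l \<in> poly_fun n" "\<And>l. l \<in> A \<Longrightarrow> homogeneous (d l) (g l)"
    and d: "\<And>l. l \<in> A \<Longrightarrow> d l \<ge> 1"
    and zeros: "\<And>z. z \<in> W \<Longrightarrow> (\<And>l. l \<in> A \<Longrightarrow> g l z = 0) \<Longrightarrow> z = (\<lambda>_. 0)"
begin

text \<open>In the slice \<open>z i = 1\<close> of \<open>W\<close> the forms have no common zero,
  since the only candidate is the origin. The Nullstellensatz applies to the ideal of functions that
  agree on \<open>W\<close> with a combination of the \<open>g l\<close> and
  \<open>z i - 1\<close>.\<close>

lemma one_eq_combination_on_affine_chart:
  assumes i: "i < n"
  shows "\<exists>b c. (\<forall>l\<in>A. b l \<in> poly_fun n) \<and> (\<forall>z\<in>W. 1 = (\<Sum>l\<in>A. g l z * b l z) + (z i - 1) * c z)"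
proof -
  define H where "H f b c \<longleftrightarrow> (\<forall>l. b l \<in> poly_fun n) \<and> c \<in> poly_fun n \<and>
     (\<forall>z\<in>W. f z = (\<Sum>l\<in>A. g l z * b l z) + (z i - 1) * c z)" for f b c
  define I where "I = {f \<in> poly_fun n. \<exists>b c. H f b c}"
  have ideal: "poly_ideal n I" unfolding poly_ideal_def
  proof (intro conjI ballI)
    show "I \<subseteq> poly_fun n" by (auto simp: I_def)
    have "H 0 (\<lambda>_. 0) 0" unfolding H_def using zero_in_poly_fun by simp
    then show "0 \<in> I" unfolding I_def using zero_in_poly_fun by blast
  next
    fix f h assume "f \<in> I" "h \<in> I"
    then obtain b c b' c' where fh: "f \<in> poly_fun n" "h \<in> poly_fun n" "H f b c" "H h b' c'"
      unfolding I_def by blast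
    have "H (f + h) (\<lambda>l. b l + b' l) (c + c')" unfolding H_def
    proof (intro conjI allI ballI)
      fix z assume "z \<in> W"
      then have "f z = (\<Sum>l\<in>A. g l z * b l z) + (z i - 1) * c z"
        "h z = (\<Sum>l\<in>A. g l z * b' l z) + (z i - 1) * c' z" using fh unfolding H_def by auto
      then show "(f + h) z = (\<Sum>l\<in>A. g l z * (b l + b' l) z) + (z i - 1) * (c + c') z"
        by (simp add: ring_distribs sum.distrib)
    qed (use fh in \<open>auto simp: H_def intro: poly_fun_add\<close>)
    then show "f + h \<in> I" unfolding I_def using poly_fun_add[OF fh(1,2)] by blast
  next
    fix f h assume "f \<in> I" and h: "h \<in> poly_fun n"
    then obtain b c where f: "f \<in> poly_fun n" "H f b c" unfolding I_def by blast
    have "H (h * f) (\<lambda>l. h * b l) (h * c)" unfolding H_def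
    proof (intro conjI allI ballI)
      fix z assume "z \<in> W"
      then have "f z = (\<Sum>l\<in>A. g l z * b l z) + (z i - 1) * c z" using f unfolding H_def by auto
      then show "(h * f) z = (\<Sum>l\<in>A. g l z * (h * b l) z) + (z i - 1) * (h * c) z"
        by (simp add: ring_distribs sum_distrib_left mult_ac)
    qed (use f h in \<open>auto simp: H_def intro: poly_fun_mult\<close>)
    then show "h * f \<in> I" unfolding I_def using poly_fun_mult[OF h f(1)] by blast
  qed
  have "1 \<in> I"
  proof (rule ccontr)
    assume "1 \<notin> I"
    from weak_nullstellensatz[OF ideal this] obtain w where w: "w \<in> aff n" "\<And>f. f \<in> I \<Longrightarrow> f w = 0"
      by auto
    obtain Q where Q: "Q \<subseteq> poly_fun n" "W = {z \<in> aff n. \<forall>f\<in>Q. f z = 0}"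
      using W(1) by (auto simp: zariski_closed_iff)
    have "f w = 0" if "f \<in> Q" for f
    proof (rule w(2))
      \<comment> \<open>Equality is demanded on \<open>W\<close> only, so the equations of
        \<open>W\<close> belong to the ideal with zero coefficients; this forces \<open>w\<close>
        into \<open>W\<close>.\<close>
      have "H f (\<lambda>_. 0) 0" unfolding H_def using zero_in_poly_fun that by (auto simp: Q(2))
      then show "f \<in> I" unfolding I_def using Q(1) that by blast
    qed
    then have wW: "w \<in> W" using w(1) by (simp add: Q(2))
    have "g l w = 0" if l: "l \<in> A" for l
    proof (rule w(2))
      have "(\<Sum>m\<in>A. g m z * (if m = l then 1 else 0) z) = g l z" for z
        using l A by (simp add: sum.remove[of A l])
      then have "H (g l) (\<lambda>m. if m = l then 1 else 0) 0"
        unfolding H_def using zero_in_poly_fun one_in_poly_fun by simp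
      then show "g l \<in> I" unfolding I_def using g(1)[OF l] by blast
    qed
    then have "w = (\<lambda>_. 0)" using zeros[OF wW] by blast
    moreover have "w i - 1 = 0"
    proof (rule w(2)[of "\<lambda>z. z i - 1"])
      have "H (\<lambda>z. z i - 1) (\<lambda>_. 0) 1" unfolding H_def using zero_in_poly_fun one_in_poly_fun by simp
      then show "(\<lambda>z. z i - 1) \<in> I" unfolding I_def using var_diff_const_in_poly_fun[OF i] by blast
    qed
    ultimately show False by simp
  qed
  then obtain b c where "H 1 b c" unfolding I_def by blast
  then show ?thesis unfolding H_def by (intro exI[of _ b] exI[of _ c]) auto
qed

text \<open>For nonzero \<open>z i\<close> the point z / z_i is again in the cone \<open>W\<close>
  and has \<open>i\<close>-th coordinate 1. The identity on the chart holds there without its last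
  term, and multiplication by \<open>z i ^ N\<close> turns it into a polynomial identity of
  controlled degree.\<close>

lemma var_power_eq_combination:
  assumes i: "i < n"
  shows "\<exists>D. \<forall>N\<ge>D. (\<forall>l\<in>A. d l \<le> N) \<and> (\<exists>b. (\<forall>l\<in>A. b l \<in> poly_fun_le n (N - d l)) \<and>
           (\<forall>z\<in>W. z i ^ N = (\<Sum>l\<in>A. g l z * b l z)))"
proof -
  obtain b c where b: "\<And>l. l \<in> A \<Longrightarrow> b l \<in> poly_fun n"
    and eq: "\<And>z. z \<in> W \<Longrightarrow> 1 = (\<Sum>l\<in>A. g l z * b l z) + (z i - 1) * c z"
    using one_eq_combination_on_affine_chart[OF i] by blast
  have "\<forall>l. \<exists>D. l \<in> A \<longrightarrow> (\<forall>N\<ge>D. \<exists>b'\<in>poly_fun_le n N. \<forall>z. z i \<noteq> 0 \<longrightarrow>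
      b' z = z i ^ N * b l (\<lambda>k. inverse (z i) * z k))"
    using poly_fun_homogenize[OF b i] by auto
  from choice[OF this] obtain D where D: "\<And>l N. l \<in> A \<Longrightarrow> N \<ge> D l \<Longrightarrow>
      \<exists>b'\<in>poly_fun_le n N. \<forall>z. z i \<noteq> 0 \<longrightarrow> b' z = z i ^ N * b l (\<lambda>k. inverse (z i) * z k)"
    by auto
  show ?thesis
  proof (intro exI[of _ "Suc (\<Sum>l\<in>A. d l + D l)"] allI impI)
    fix N assume N: "Suc (\<Sum>l\<in>A. d l + D l) \<le> N"
    have le: "d l + D l < N" if "l \<in> A" for l
      using member_le_sum[of l A "\<lambda>l. d l + D l"] that A N by simp
    have "\<forall>l. \<exists>b'. l \<in> A \<longrightarrow> b' \<in> poly_fun_le n (N - d l - 1) \<and> (\<forall>z. z i \<noteq> 0 \<longrightarrow>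
        b' z = z i ^ (N - d l - 1) * b l (\<lambda>k. inverse (z i) * z k))"
    proof
      fix l
      show "\<exists>b'. l \<in> A \<longrightarrow> b' \<in> poly_fun_le n (N - d l - 1) \<and> (\<forall>z. z i \<noteq> 0 \<longrightarrow>
        b' z = z i ^ (N - d l - 1) * b l (\<lambda>k. inverse (z i) * z k))"
      proof (cases "l \<in> A")
        case True
        then have "D l \<le> N - d l - 1" using le[of l] by simp
        from D[OF True this] show ?thesis by (elim bexE) (intro exI impI conjI)
      qed simp
    qed
    from choice[OF this] obtain b' where b': "\<And>l. l \<in> A \<Longrightarrow> b' l \<in> poly_fun_le n (N - d l - 1)"
      "\<And>l z. l \<in> A \<Longrightarrow> z i \<noteq> 0 \<Longrightarrow> b' l z = z i ^ (N - d l - 1) * b l (\<lambda>k. inverse (z i) * z k)"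
      by auto
    \<comment> \<open>One factor \<open>z i\<close> is held back, which explains the exponent
      \<open>N - d l - 1\<close> and the \<open>Suc\<close> in the bound for \<open>N\<close>: both
      sides then vanish at points with \<open>z i = 0\<close>, where division was
      impossible.\<close>
    define b'' where "b'' l = (\<lambda>z. z i ^ 1) * b' l" for l
    have "b'' l \<in> poly_fun_le n (N - d l)" if "l \<in> A" for l
    proof -
      have "b'' l \<in> poly_fun_le n (1 + (N - d l - 1))" unfolding b''_def
        by (intro poly_fun_le_mult var_power_in_poly_fun_le i b' that)
      moreover have "1 + (N - d l - 1) = N - d l" using le[OF that] by simp
      ultimately show ?thesis by (simp only:)
    qed
    moreover have "z i ^ N = (\<Sum>l\<in>A. g l z * b'' l z)" if z: "z \<in> W" for z
    proof (cases "z i = 0")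
      case True
      then show ?thesis using N by (simp add: b''_def)
    next
      case False
      let ?z = "\<lambda>k. inverse (z i) * z k"
      have "?z \<in> W" using W(2) z unfolding is_cone_def by blast
      from eq[OF this] have "1 = (\<Sum>l\<in>A. g l ?z * b l ?z)" using False by simp
      then have "z i ^ N = (\<Sum>l\<in>A. z i ^ N * (g l ?z * b l ?z))"
        by (simp flip: sum_distrib_left)
      also have "\<dots> = (\<Sum>l\<in>A. g l z * b'' l z)"
      proof (rule sum.cong[OF refl])
        fix l assume l: "l \<in> A"
        have gz: "g l ?z = inverse (z i) ^ d l * g l z" using g(2)[OF l] by (simp add: homogeneous_def)
        have "N = d l + Suc (N - d l - 1)" using le[OF l] by simp
        then have "z i ^ N = z i ^ d l * z i ^ Suc (N - d l - 1)" by (metis power_add)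
        then have "z i ^ N * inverse (z i) ^ d l = z i * z i ^ (N - d l - 1)"
          using False by (simp add: power_inverse field_simps)
        then show "z i ^ N * (g l ?z * b l ?z) = g l z * b'' l z"
          using b'(2)[of l z, OF l False] by (simp add: gz b''_def)
      qed
      finally show ?thesis .
    qed
    moreover have "d l \<le> N" if "l \<in> A" for l using le[OF that] by simp
    ultimately show "(\<forall>l\<in>A. d l \<le> N) \<and> (\<exists>b. (\<forall>l\<in>A. b l \<in> poly_fun_le n (N - d l)) \<and>
        (\<forall>z\<in>W. z i ^ N = (\<Sum>l\<in>A. g l z * b l z)))"
      by (intro conjI exI[of _ b'']) auto
  qed
qed

text \<open>Replacing \<open>z i ^ N\<close> by a combination of the forms, again and again, writes
  every function on \<open>W\<close> through monomials with exponents below \<open>N\<close>, with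
  products of the \<open>g l\<close> as coefficients. In degree \<open>s\<close> each form occurs at
  most \<open>s\<close> times, so there are at most N^n (s+1)^(card A) products.\<close>

lemma hilb_le_of_forms: "hilb_le n W (card A)"
proof -
  have "\<forall>i. \<exists>D. i < n \<longrightarrow> (\<forall>N\<ge>D. (\<forall>l\<in>A. d l \<le> N) \<and> (\<exists>b. (\<forall>l\<in>A. b l \<in> poly_fun_le n (N - d l)) \<and>
           (\<forall>z\<in>W. z i ^ N = (\<Sum>l\<in>A. g l z * b l z))))"
    using var_power_eq_combination by auto
  from choice[OF this] obtain D where D: "\<And>i N. i < n \<Longrightarrow> N \<ge> D i \<Longrightarrow>
      (\<forall>l\<in>A. d l \<le> N) \<and> (\<exists>b. (\<forall>l\<in>A. b l \<in> poly_fun_le n (N - d l)) \<and>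
           (\<forall>z\<in>W. z i ^ N = (\<Sum>l\<in>A. g l z * b l z)))"
    by (elim exE) blast
  define N where "N = Suc (\<Sum>i<n. D i)"
  have DN: "D i \<le> N" if "i < n" for i
    using member_le_sum[of i "{..<n}" D] that by (simp add: N_def)
  define F where "F \<gamma> e = (\<lambda>z. \<Prod>l\<in>A. g l z ^ \<gamma> l) * monom_fun n e" for \<gamma> :: "'i \<Rightarrow> nat" and e
  define P where "P s = (A \<rightarrow>\<^sub>E {..s}) \<times> ({..<n} \<rightarrow>\<^sub>E {..<N})" for s :: nat
  define T where "T s = (\<lambda>(\<gamma>, e). F \<gamma> e) ` P s" for s
  have finP: "finite (P s)" for s unfolding P_def using A by (intro finite_cartesian_product finite_PiE) auto
  have "card (T s) \<le> N ^ n * (s + 1) ^ card A" for s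
  proof -
    have "card (T s) \<le> card (P s)" unfolding T_def by (rule card_image_le[OF finP])
    also have "\<dots> = N ^ n * (s + 1) ^ card A"
      using A by (simp add: P_def card_cartesian_product card_PiE)
    finally show ?thesis .
  qed
  \<comment> \<open>Multiplication by \<open>g l\<close> raises a single exponent of
    \<open>\<gamma>\<close> by one.\<close>
  moreover have step: "g l * f \<in> spanned_on W (T (Suc s))" if l: "l \<in> A" and f: "f \<in> spanned_on W (T s)" for l f s
  proof -
    obtain h where h: "h \<in> fv.span (T s)" "\<forall>z\<in>W. f z = h z" using f unfolding spanned_on_def by auto
    have "g l * h \<in> fv.span (T (Suc s))"
    proof (rule span_mult_mem[OF fv.subspace_span _ fv.span_base[of _ "{g l}"] h(1)])
      fix x y assume x: "x \<in> {g l}" and "y \<in> T s"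
      then obtain \<gamma> e where y: "y = F \<gamma> e" "(\<gamma>, e) \<in> P s" unfolding T_def by auto
      have "(\<Prod>m\<in>A. g m z ^ (\<gamma>(l := Suc (\<gamma> l))) m) = g l z * (\<Prod>m\<in>A. g m z ^ \<gamma> m)" for z
        using l A by (simp add: prod.remove[of A l])
      then have "x * y = F (\<gamma>(l := Suc (\<gamma> l))) e"
        using x y by (auto simp: F_def fun_eq_iff)
      moreover have "(\<gamma>(l := Suc (\<gamma> l)), e) \<in> P (Suc s)"
        using y(2) l by (auto simp: P_def PiE_iff extensional_def le_Suc_eq)
      ultimately have "x * y \<in> T (Suc s)" unfolding T_def by (intro image_eqI) auto
      then show "x * y \<in> fv.span (T (Suc s))" by (rule fv.span_base)
    qed simp
    then show ?thesis unfolding spanned_on_def using h(2) by (intro CollectI bexI[of _ "g l * h"]) auto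
  qed
  have "poly_fun_le n s \<subseteq> spanned_on W (T s)" for s
  proof (induction s rule: less_induct)
    case (less s)
    show ?case
    proof (rule poly_fun_le_spanned_onI)
      fix e :: "nat \<Rightarrow> nat" assume e: "(\<Sum>i<n. e i) \<le> s"
      show "monom_fun n e \<in> spanned_on W (T s)"
      proof (cases "\<exists>i<n. N \<le> e i")
        case False
        have "F (restrict (\<lambda>_. 0) A) (restrict e {..<n}) = monom_fun n (restrict e {..<n})"
          by (auto simp: F_def fun_eq_iff)
        also have "\<dots> = monom_fun n e" by (rule monom_fun_cong) auto
        finally have "monom_fun n e = F (restrict (\<lambda>_. 0) A) (restrict e {..<n})" ..
        moreover have "(restrict (\<lambda>_. 0) A, restrict e {..<n}) \<in> P s"
          using False by (auto simp: P_def not_le)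
        ultimately have "monom_fun n e \<in> T s" unfolding T_def by (intro image_eqI) auto
        then show ?thesis by (rule spanned_on_base)
      next
        case True
        then obtain i where i: "i < n" "N \<le> e i" by blast
        obtain b where dN: "\<And>l. l \<in> A \<Longrightarrow> d l \<le> N"
          and b: "\<And>l. l \<in> A \<Longrightarrow> b l \<in> poly_fun_le n (N - d l)"
          and eq: "\<And>z. z \<in> W \<Longrightarrow> z i ^ N = (\<Sum>l\<in>A. g l z * b l z)"
          using D[OF i(1) DN[OF i(1)]] by auto
        define e' where "e' = e(i := e i - N)"
        have mon: "monom_fun n e z = z i ^ N * monom_fun n e' z" for z
          using i by (simp add: monom_fun_def e'_def prod.remove[of "{..<n}" i] flip: power_add)
        have "(\<Sum>k<n. e k) = N + (\<Sum>k<n. e' k)"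
          using i by (simp add: e'_def sum.remove[of "{..<n}" i])
        then have deg: "N + (\<Sum>k<n. e' k) \<le> s" using e by simp
        have s: "s = Suc (s - 1)" using deg by (simp add: N_def)
        have "g l * (b l * monom_fun n e') \<in> spanned_on W (T s)" if l: "l \<in> A" for l
        proof -
          have "b l * monom_fun n e' \<in> poly_fun_le n (N - d l + (\<Sum>k<n. e' k))"
            by (rule poly_fun_le_mult[OF b[OF l]]) (auto simp: poly_fun_le_def intro: fv.span_base)
          \<comment> \<open>Since \<open>g l\<close> has positive degree, the cofactor has degree
            below \<open>s\<close> and the induction hypothesis applies to it.\<close>
          moreover have "N - d l + (\<Sum>k<n. e' k) \<le> s - 1"
            using deg d[OF l] dN[OF l] by simp
          ultimately have "b l * monom_fun n e' \<in> poly_fun_le n (s - 1)"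
            using poly_fun_le_mono by blast
          then have "b l * monom_fun n e' \<in> spanned_on W (T (s - 1))" using less[of "s - 1"] s by auto
          from step[OF l this] show ?thesis using s by simp
        qed
        then have "(\<Sum>l\<in>A. g l * (b l * monom_fun n e')) \<in> spanned_on W (T s)"
          by (rule fv.subspace_sum[OF subspace_spanned_on])
        then show ?thesis
        proof (rule spanned_on_cong)
          fix z assume "z \<in> W"
          then show "monom_fun n e z = (\<Sum>l\<in>A. g l * (b l * monom_fun n e')) z"
            unfolding mon eq[OF \<open>z \<in> W\<close>] sum_fun_apply sum_distrib_right by (simp add: mult_ac)
        qed
      qed
    qed
  qed
  moreover have "finite (T s)" for s unfolding T_def by (intro finite_imageI finP)
  ultimately show ?thesis by (intro hilb_leI[where C = "N ^ n"] exI[of _ "T _"]) auto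
qed

end

subsection \<open>Noetherianity\<close>

definition poly_acc :: "nat \<Rightarrow> bool" where
  "poly_acc n \<longleftrightarrow> (\<forall>I. (\<forall>k::nat. poly_ideal n (I k)) \<longrightarrow> (\<forall>k. I k \<subseteq> I (Suc k)) \<longrightarrow>
     (\<exists>m. \<forall>k\<ge>m. I k = I m))"

text \<open>Without variables all polynomials are constant, so an ideal is either zero or
  everything.\<close>

lemma poly_acc_0: "poly_acc 0"
  unfolding poly_acc_def
proof (intro allI impI)
  fix I :: "nat \<Rightarrow> ((nat \<Rightarrow> complex) \<Rightarrow> complex) set"
  assume I: "\<forall>k. poly_ideal 0 (I k)" and mono: "\<forall>k. I k \<subseteq> I (Suc k)"
  let ?K = "range (\<lambda>(c :: complex) (_ :: nat \<Rightarrow> complex). c)"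
  have "poly_fun 0 \<subseteq> ?K"
    unfolding poly_fun_def
  proof (rule fv.span_minimal)
    have "monom_fun 0 e = (\<lambda>_. 1)" for e by (auto simp: monom_fun_def)
    then show "range (monom_fun 0) \<subseteq> ?K" by auto
    show "fv.subspace (?K)" unfolding fv.subspace_def
    proof (intro conjI ballI allI)
      show "0 \<in> ?K" by (rule range_eqI[of _ _ 0]) (simp add: zero_fun_def)
    next
      fix f g :: "(nat \<Rightarrow> complex) \<Rightarrow> complex"
      assume "f \<in> ?K" "g \<in> ?K"
      then obtain a b where "f = (\<lambda>_. a)" "g = (\<lambda>_. b)" by (elim rangeE)
      then show "f + g \<in> ?K" by (intro range_eqI[of _ _ "a + b"]) (simp add: plus_fun_def)
    next
      fix r and f :: "(nat \<Rightarrow> complex) \<Rightarrow> complex"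
      assume "f \<in> ?K"
      then obtain a where "f = (\<lambda>_. a)" by (elim rangeE)
      then show "cscale r f \<in> ?K" by (intro range_eqI[of _ _ "r * a"]) (simp add: cscale_def)
    qed
  qed
  then have const: "\<exists>c. f = (\<lambda>_. c)" if f: "f \<in> poly_fun 0" for f
    by (rule rangeE[OF subsetD[OF _ f]]) (rule exI)
  show "\<exists>m. \<forall>k\<ge>m. I k = I m"
  proof (cases "\<exists>m. I m \<noteq> {0}")
    case True
    then obtain m where m: "I m \<noteq> {0}" by blast
    have "0 \<in> I m" using I poly_idealD(2) by auto
    with m obtain f where f: "f \<in> I m" "f \<noteq> 0" by blast
    have full: "I k = poly_fun 0" if "k \<ge> m" for k
    proof
      show "I k \<subseteq> poly_fun 0" using I poly_idealD(1) by blast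
      have fk: "f \<in> I k" using lift_Suc_mono_le[of I m k] mono that f(1) by blast
      then have "f \<in> poly_fun 0" using I poly_idealD(1) by blast
      from const[OF this] obtain c where c: "f = (\<lambda>_. c)" by (elim exE)
      then have c0: "c \<noteq> 0" using f(2) by (auto simp: zero_fun_def)
      show "poly_fun 0 \<subseteq> I k"
      proof
        fix h assume "h \<in> poly_fun 0"
        from const[OF this] obtain r where r: "h = (\<lambda>_. r)" by (elim exE)
        have "cscale (r / c) f \<in> I k" by (rule poly_ideal_scale[OF I[rule_format] fk])
        then show "h \<in> I k" using c0 by (simp add: cscale_def c r)
      qed
    qed
    then show ?thesis by (intro exI[of _ m]) simp
  qed auto
qed

text \<open>Hilbert's basis theorem: ideals in one more variable are controlled by the ideals of leading
  coefficients with respect to that variable. The set \<open>low_deg n m\<close> consists of the polynomials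
  in \<open>x\<^sub>0, \<dots>, x\<^sub>n\<close> of degree less than \<open>m\<close> in \<open>x\<^sub>n\<close>.\<close>

definition low_deg :: "nat \<Rightarrow> nat \<Rightarrow> ((nat \<Rightarrow> complex) \<Rightarrow> complex) set" where
  "low_deg n m = {\<Sum>j<m. c j * (\<lambda>z. z n) ^ j | c. \<forall>j. c j \<in> poly_fun n}"

definition lead_ideal ::
  "nat \<Rightarrow> nat \<Rightarrow> ((nat \<Rightarrow> complex) \<Rightarrow> complex) set \<Rightarrow> ((nat \<Rightarrow> complex) \<Rightarrow> complex) set" where
  "lead_ideal n m I = {c \<in> poly_fun n. \<exists>h\<in>low_deg n m. c * (\<lambda>z. z n) ^ m + h \<in> I}"

lemma low_deg_0: "low_deg n 0 = {0}"
  using zero_in_poly_fun[of n] by (auto simp: low_deg_def intro!: exI[of _ "\<lambda>_. 0"])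

lemma zero_in_low_deg: "0 \<in> low_deg n m"
  unfolding low_deg_def by (intro CollectI exI[of _ "\<lambda>_. 0"]) (auto simp: zero_in_poly_fun)

lemma low_deg_add:
  assumes "f \<in> low_deg n m" "h \<in> low_deg n m" shows "f + h \<in> low_deg n m"
proof -
  obtain c c' where "f = (\<Sum>j<m. c j * (\<lambda>z. z n) ^ j)" "\<forall>j. c j \<in> poly_fun n"
    "h = (\<Sum>j<m. c' j * (\<lambda>z. z n) ^ j)" "\<forall>j. c' j \<in> poly_fun n"
    using assms unfolding low_deg_def by auto
  then show ?thesis unfolding low_deg_def
    by (intro CollectI exI[of _ "\<lambda>j. c j + c' j"]) (simp add: distrib_right sum.distrib poly_fun_add)
qed

lemma low_deg_mult:
  assumes "f \<in> low_deg n m" "h \<in> poly_fun n" shows "h * f \<in> low_deg n m"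
proof -
  obtain c where "f = (\<Sum>j<m. c j * (\<lambda>z. z n) ^ j)" "\<forall>j. c j \<in> poly_fun n"
    using assms unfolding low_deg_def by auto
  then show ?thesis unfolding low_deg_def using assms(2)
    by (intro CollectI exI[of _ "\<lambda>j. h * c j"]) (simp add: sum_distrib_left mult.assoc poly_fun_mult)
qed

lemma low_deg_diff:
  assumes "f \<in> low_deg n m" "h \<in> low_deg n m" shows "f - h \<in> low_deg n m"
proof -
  have "f + (\<lambda>_. - 1) * h \<in> low_deg n m"
    by (intro low_deg_add low_deg_mult assms const_in_poly_fun)
  also have "f + (\<lambda>_. - 1) * h = f - h" by (auto simp: fun_eq_iff)
  finally show ?thesis .
qed

lemma low_deg_Suc_iff:
  "f \<in> low_deg n (Suc m) \<longleftrightarrow> (\<exists>c\<in>poly_fun n. \<exists>h\<in>low_deg n m. f = c * (\<lambda>z. z n) ^ m + h)"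
proof
  assume "f \<in> low_deg n (Suc m)"
  then obtain c where c: "f = (\<Sum>j<Suc m. c j * (\<lambda>z. z n) ^ j)" "\<forall>j. c j \<in> poly_fun n"
    unfolding low_deg_def by auto
  then have "f = c m * (\<lambda>z. z n) ^ m + (\<Sum>j<m. c j * (\<lambda>z. z n) ^ j)" by (simp add: add.commute)
  moreover have "(\<Sum>j<m. c j * (\<lambda>z. z n) ^ j) \<in> low_deg n m" using c(2) unfolding low_deg_def by auto
  ultimately show "\<exists>c\<in>poly_fun n. \<exists>h\<in>low_deg n m. f = c * (\<lambda>z. z n) ^ m + h" using c(2) by blast
next
  assume "\<exists>c\<in>poly_fun n. \<exists>h\<in>low_deg n m. f = c * (\<lambda>z. z n) ^ m + h"
  then obtain c h where c: "c \<in> poly_fun n" "h \<in> low_deg n m" "f = c * (\<lambda>z. z n) ^ m + h" by blast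
  then obtain b where b: "h = (\<Sum>j<m. b j * (\<lambda>z. z n) ^ j)" "\<forall>j. b j \<in> poly_fun n"
    unfolding low_deg_def by auto
  have "f = (\<Sum>j<Suc m. (b(m := c)) j * (\<lambda>z. z n) ^ j)" unfolding c(3) b(1) by (simp add: add.commute)
  moreover have "\<forall>j. (b(m := c)) j \<in> poly_fun n" using b c by simp
  ultimately show "f \<in> low_deg n (Suc m)" unfolding low_deg_def by blast
qed

lemma low_deg_mono: "m \<le> m' \<Longrightarrow> low_deg n m \<subseteq> low_deg n m'"
proof (induction rule: dec_induct)
  case (step k)
  have "low_deg n k \<subseteq> low_deg n (Suc k)"
  proof
    fix h assume "h \<in> low_deg n k"
    then show "h \<in> low_deg n (Suc k)" unfolding low_deg_Suc_iff
      using zero_in_poly_fun by (intro bexI[of _ 0] bexI[of _ h]) auto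
  qed
  then show ?case using step by blast
qed simp

lemma low_deg_mult_var:
  "h \<in> low_deg n m \<Longrightarrow> (\<lambda>z. z n) * h \<in> low_deg n (Suc m)"
proof (induction m arbitrary: h)
  case 0
  then show ?case by (simp only: low_deg_0 singleton_iff mult_zero_right zero_in_low_deg)
next
  case (Suc m)
  from Suc.prems obtain c h' where c: "c \<in> poly_fun n" "h' \<in> low_deg n m" "h = c * (\<lambda>z. z n) ^ m + h'"
    unfolding low_deg_Suc_iff[of h] by blast
  have "(\<lambda>z. z n) * h = c * (\<lambda>z. z n) ^ Suc m + (\<lambda>z. z n) * h'"
    unfolding c(3) by (simp add: algebra_simps)
  then show ?case unfolding low_deg_Suc_iff[of _ n "Suc m"] using c(1) Suc.IH[OF c(2)] by blast
qed

lemma low_deg_mult_low: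
  assumes "f \<in> low_deg n m" "h \<in> low_deg n m'" shows "f * h \<in> low_deg n (m + m')"
  using assms(1)
proof (induction m arbitrary: f)
  case 0
  then have "f = 0" by (simp add: low_deg_0)
  then show ?case by (simp only: mult_zero_left zero_in_low_deg)
next
  case (Suc m)
  then obtain c h' where c: "c \<in> poly_fun n" "h' \<in> low_deg n m" "f = c * (\<lambda>z. z n) ^ m + h'"
    unfolding low_deg_Suc_iff by blast
  have pw: "(\<lambda>z. z n) ^ k * h \<in> low_deg n (k + m')" for k
  proof (induction k)
    case 0
    then show ?case using assms(2) by (simp only: power_0 mult_1_left add_0)
  next
    case (Suc k)
    show ?case unfolding power_Suc mult.assoc add_Suc by (rule low_deg_mult_var[OF Suc])
  qed
  have "c * ((\<lambda>z. z n) ^ m * h) + h' * h \<in> low_deg n (m + m')"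
    by (intro low_deg_add low_deg_mult pw c Suc.IH)
  also have "c * ((\<lambda>z. z n) ^ m * h) + h' * h = f * h" unfolding c(3) by (simp add: algebra_simps)
  finally show ?case using low_deg_mono[of "m + m'" "Suc m + m'" n] by auto
qed

lemma poly_fun_Suc_low_deg:
  assumes "f \<in> poly_fun (Suc n)" shows "\<exists>m. f \<in> low_deg n m"
proof (rule poly_fun_induct[OF assms, of "\<lambda>f. \<exists>m. f \<in> low_deg n m"])
  have base: "f \<in> low_deg n 1" if "f \<in> poly_fun n" for f
    using that zero_in_low_deg[of n 0]
    unfolding One_nat_def low_deg_Suc_iff by (intro bexI[of _ f] bexI[of _ 0]) auto
  show "\<exists>m. (\<lambda>_. c) \<in> low_deg n m" for c
    using base[OF const_in_poly_fun] by (rule exI)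
  show "\<exists>m. (\<lambda>z. z i) \<in> low_deg n m" if "i < Suc n" for i
  proof (cases "i = n")
    case True
    have "(\<lambda>z. z n) * 1 \<in> low_deg n (Suc 1)" by (rule low_deg_mult_var[OF base[OF one_in_poly_fun]])
    then have "(\<lambda>z. z n) \<in> low_deg n (Suc 1)" by (simp only: mult_1_right)
    then show ?thesis unfolding True by (rule exI)
  next
    case False
    then have "i < n" using that by simp
    from base[OF var_in_poly_fun[OF this]] show ?thesis by (rule exI)
  qed
next
  fix f g assume "\<exists>m. f \<in> low_deg n m" "\<exists>m. g \<in> low_deg n m"
  then obtain m m' where m: "f \<in> low_deg n m" "g \<in> low_deg n m'" by blast
  have "f \<in> low_deg n (max m m')" "g \<in> low_deg n (max m m')"
    using m low_deg_mono[of m "max m m'"] low_deg_mono[of m' "max m m'"] by auto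
  from low_deg_add[OF this] show "\<exists>m. f + g \<in> low_deg n m" by (rule exI)
  from low_deg_mult_low[OF m] show "\<exists>m. f * g \<in> low_deg n m" by (rule exI)
qed

lemma lead_idealI:
  "c \<in> poly_fun n \<Longrightarrow> h \<in> low_deg n m \<Longrightarrow> c * (\<lambda>z. z n) ^ m + h \<in> I \<Longrightarrow> c \<in> lead_ideal n m I"
  unfolding lead_ideal_def by blast

lemma lead_idealE:
  assumes "c \<in> lead_ideal n m I"
  obtains h where "c \<in> poly_fun n" "h \<in> low_deg n m" "c * (\<lambda>z. z n) ^ m + h \<in> I"
  using assms unfolding lead_ideal_def by blast

lemma poly_ideal_lead_ideal:
  assumes I: "poly_ideal (Suc n) I" shows "poly_ideal n (lead_ideal n m I)"
  unfolding poly_ideal_def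
proof (intro conjI ballI)
  show "lead_ideal n m I \<subseteq> poly_fun n" by (auto simp: lead_ideal_def)
  show "0 \<in> lead_ideal n m I"
    by (rule lead_idealI[OF zero_in_poly_fun zero_in_low_deg])
      (use poly_idealD(2)[OF I] in \<open>simp only: mult_zero_left add_0\<close>)
next
  fix f g assume "f \<in> lead_ideal n m I" "g \<in> lead_ideal n m I"
  then obtain h h' where h: "f \<in> poly_fun n" "h \<in> low_deg n m" "f * (\<lambda>z. z n) ^ m + h \<in> I"
    "g \<in> poly_fun n" "h' \<in> low_deg n m" "g * (\<lambda>z. z n) ^ m + h' \<in> I" by (elim lead_idealE)
  show "f + g \<in> lead_ideal n m I"
  proof (rule lead_idealI[OF poly_fun_add[OF h(1,4)] low_deg_add[OF h(2,5)]])
    from poly_idealD(3)[OF I h(3,6)] show "(f + g) * (\<lambda>z. z n) ^ m + (h + h') \<in> I"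
      by (simp only: distrib_right add_ac)
  qed
next
  fix f g assume "f \<in> lead_ideal n m I" and g: "g \<in> poly_fun n"
  then obtain h where h: "f \<in> poly_fun n" "h \<in> low_deg n m" "f * (\<lambda>z. z n) ^ m + h \<in> I"
    by (elim lead_idealE)
  show "g * f \<in> lead_ideal n m I"
  proof (rule lead_idealI[OF poly_fun_mult[OF g h(1)] low_deg_mult[OF h(2) g]])
    from poly_idealD(4)[OF I h(3) poly_fun_Suc[OF g]] show "(g * f) * (\<lambda>z. z n) ^ m + g * h \<in> I"
      by (simp only: distrib_left mult.assoc)
  qed
qed

lemma lead_ideal_mono: "I \<subseteq> I' \<Longrightarrow> lead_ideal n m I \<subseteq> lead_ideal n m I'"
  unfolding lead_ideal_def by blast

text \<open>Multiplication by the last variable moves a leading coefficient from degree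
  \<open>m\<close> to \<open>Suc m\<close>.\<close>

lemma lead_ideal_Suc:
  assumes I: "poly_ideal (Suc n) I" shows "lead_ideal n m I \<subseteq> lead_ideal n (Suc m) I"
proof
  fix c assume "c \<in> lead_ideal n m I"
  then obtain h where h: "c \<in> poly_fun n" "h \<in> low_deg n m" "c * (\<lambda>z. z n) ^ m + h \<in> I"
    by (elim lead_idealE)
  show "c \<in> lead_ideal n (Suc m) I"
  proof (rule lead_idealI[OF h(1) low_deg_mult_var[OF h(2)]])
    have "(\<lambda>z. z n) * (c * (\<lambda>z. z n) ^ m + h) \<in> I"
      by (rule poly_idealD(4)[OF I h(3) var_in_poly_fun]) simp
    also have "(\<lambda>z. z n) * (c * (\<lambda>z. z n) ^ m + h) = c * (\<lambda>z. z n) ^ Suc m + (\<lambda>z. z n) * h"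
      by (simp only: power_Suc distrib_left mult_ac)
    finally show "c * (\<lambda>z. z n) ^ Suc m + (\<lambda>z. z n) * h \<in> I" .
  qed
qed

text \<open>Induction on the degree in the last variable: a member of \<open>I'\<close> shares its
  leading coefficient with some member of \<open>I\<close>, and their difference lies in
  \<open>I'\<close> and has lower degree.\<close>

lemma ideal_eq_of_lead_ideals:
  assumes I: "poly_ideal (Suc n) I" and I': "poly_ideal (Suc n) I'" and sub: "I \<subseteq> I'"
    and lead: "\<And>m. lead_ideal n m I' \<subseteq> lead_ideal n m I"
  shows "I' = I"
proof -
  have *: "\<forall>f. f \<in> low_deg n m \<longrightarrow> f \<in> I' \<longrightarrow> f \<in> I" for m
  proof (induction m)
    case 0
    show ?case
    proof (intro allI impI)
      fix f assume "f \<in> low_deg n 0"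
      then have "f = 0" by (simp only: low_deg_0 singleton_iff)
      then show "f \<in> I" using poly_idealD(2)[OF I] by (simp only:)
    qed
  next
    case (Suc m)
    show ?case
    proof (intro allI impI)
      fix f assume f: "f \<in> low_deg n (Suc m)" "f \<in> I'"
      then obtain c h where c: "c \<in> poly_fun n" "h \<in> low_deg n m" "f = c * (\<lambda>z. z n) ^ m + h"
        unfolding low_deg_Suc_iff by blast
      have "c \<in> lead_ideal n m I'" by (rule lead_idealI[OF c(1,2) f(2)[unfolded c(3)]])
      then have "c \<in> lead_ideal n m I" using lead by blast
      then obtain h' where h': "h' \<in> low_deg n m" "c * (\<lambda>z. z n) ^ m + h' \<in> I" by (elim lead_idealE)
      have eq: "f - (c * (\<lambda>z. z n) ^ m + h') = h - h'" unfolding c(3) by simp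
      have "f - (c * (\<lambda>z. z n) ^ m + h') \<in> I'" using f(2) h'(2) sub by (intro poly_ideal_diff[OF I']) auto
      then have "h - h' \<in> I" unfolding eq using Suc low_deg_diff[OF c(2) h'(1)] by blast
      then have "(h - h') + (c * (\<lambda>z. z n) ^ m + h') \<in> I" using h'(2) by (rule poly_idealD(3)[OF I])
      also have "(h - h') + (c * (\<lambda>z. z n) ^ m + h') = f" unfolding c(3) by simp
      finally show "f \<in> I" .
    qed
  qed
  have "f \<in> I" if f: "f \<in> I'" for f
  proof -
    obtain m where "f \<in> low_deg n m" using poly_fun_Suc_low_deg poly_idealD(1)[OF I'] f by blast
    then show ?thesis using * f by blast
  qed
  then show ?thesis using sub by blast
qed

lemma poly_acc_Suc:
  assumes acc: "poly_acc n" shows "poly_acc (Suc n)"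
  unfolding poly_acc_def
proof (intro allI impI)
  fix I :: "nat \<Rightarrow> ((nat \<Rightarrow> complex) \<Rightarrow> complex) set"
  assume I: "\<forall>k. poly_ideal (Suc n) (I k)" and mono: "\<forall>k. I k \<subseteq> I (Suc k)"
  have Imono: "I j \<subseteq> I k" if "j \<le> k" for j k using lift_Suc_mono_le[of I j k] mono that by blast
  have Lmono: "lead_ideal n m (I j) \<subseteq> lead_ideal n m' (I k)" if "m \<le> m'" "j \<le> k" for m m' j k
  proof -
    have "lead_ideal n m (I j) \<subseteq> lead_ideal n m' (I j)"
      by (rule lift_Suc_mono_le[of "\<lambda>m. lead_ideal n m (I j)", OF lead_ideal_Suc[OF I[rule_format]] that(1)])
    then show ?thesis using lead_ideal_mono[OF Imono[OF that(2)]] by blast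
  qed
  \<comment> \<open>The leading ideals form a doubly indexed family, increasing in both indices. The
    identity as \<open>\<mu>\<close> gives stability along the diagonal, constant
    \<open>\<mu>\<close> stability for one fixed degree.\<close>
  have stab: "\<exists>m. \<forall>k\<ge>m. lead_ideal n (\<mu> k) (I k) = lead_ideal n (\<mu> m) (I m)" if "mono \<mu>" for \<mu> :: "nat \<Rightarrow> nat"
  proof -
    have "\<forall>k. poly_ideal n (lead_ideal n (\<mu> k) (I k))" using I poly_ideal_lead_ideal by simp
    moreover have "\<forall>k. lead_ideal n (\<mu> k) (I k) \<subseteq> lead_ideal n (\<mu> (Suc k)) (I (Suc k))"
      using that by (intro allI Lmono) (simp_all add: mono_def)
    ultimately show ?thesis
      by (rule acc[unfolded poly_acc_def, THEN spec[of _ "\<lambda>k. lead_ideal n (\<mu> k) (I k)"], THEN mp, THEN mp])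
  qed
  obtain r where r: "\<And>k. k \<ge> r \<Longrightarrow> lead_ideal n k (I k) = lead_ideal n r (I r)"
    using stab[of "\<lambda>k. k"] by (auto simp: mono_def)
  have "\<exists>q. \<forall>k\<ge>q. lead_ideal n m (I k) = lead_ideal n m (I q)" for m
    by (rule stab[of "\<lambda>_. m"]) (simp add: mono_def)
  then have "\<forall>m. \<exists>q. \<forall>k\<ge>q. lead_ideal n m (I k) = lead_ideal n m (I q)" by (rule allI)
  from choice[OF this] obtain q where
    q: "\<And>m k. k \<ge> q m \<Longrightarrow> lead_ideal n m (I k) = lead_ideal n m (I (q m))" by auto
  define M where "M = r + (\<Sum>m<r. q m)"
  have "I k = I M" if k: "k \<ge> M" for k
  proof (rule ideal_eq_of_lead_ideals[of n])
    show "poly_ideal (Suc n) (I M)" "poly_ideal (Suc n) (I k)" using I by auto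
    show "I M \<subseteq> I k" by (rule Imono[OF k])
    show "lead_ideal n m (I k) \<subseteq> lead_ideal n m (I M)" for m
    proof (cases "m < r")
      case True
      then have "q m \<le> M" using member_le_sum[of m "{..<r}" q] by (simp add: M_def)
      then show ?thesis using q[of m M] q[of m k] k by simp
    next
      case False
      \<comment> \<open>For \<open>m \<ge> r\<close> the ideal is squeezed between two places where
        the diagonal is already stable, so only the finitely many degrees below \<open>r\<close>
        have to be treated one by one.\<close>
      have "lead_ideal n m (I k) \<subseteq> lead_ideal n (max m k) (I (max m k))" by (rule Lmono) auto
      also have "\<dots> = lead_ideal n r (I r)" using False by (intro r) auto
      also have "\<dots> \<subseteq> lead_ideal n m (I M)" using False by (intro Lmono) (auto simp: M_def)
      finally show ?thesis .
    qed
  qed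
  then show "\<exists>m. \<forall>k\<ge>m. I k = I m" by blast
qed

lemma poly_acc: "poly_acc n"
  by (induction n) (auto intro: poly_acc_0 poly_acc_Suc)

section \<open>Decomposition into irreducible closed sets\<close>

lemma zariski_closed_dcc:
  assumes V: "\<And>k::nat. zariski_closed n (V k)" and mono: "\<And>k. V (Suc k) \<subseteq> V k"
  shows "\<exists>m. \<forall>k\<ge>m. V k = V m"
proof -
  \<comment> \<open>Vanishing ideals reverse inclusions, and a closed set is recovered from its
    ideal, so a descending chain of sets stabilises together with the ascending chain of
    ideals.\<close>
  define I where "I k = {f \<in> poly_fun n. \<forall>z\<in>V k. f z = 0}" for k
  have VI: "V k = {z \<in> aff n. \<forall>f\<in>I k. f z = 0}" for k
  proof -
    obtain Q where Q: "Q \<subseteq> poly_fun n" "V k = {z \<in> aff n. \<forall>f\<in>Q. f z = 0}"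
      using V[of k] unfolding zariski_closed_iff by (elim exE conjE)
    have "f z = 0" if "f \<in> Q" "z \<in> V k" for f z using that unfolding Q(2) by simp
    then have QI: "Q \<subseteq> I k" using Q(1) unfolding I_def by auto
    show ?thesis
    proof (rule set_eqI, rule iffI)
      fix z assume "z \<in> V k"
      then show "z \<in> {z \<in> aff n. \<forall>f\<in>I k. f z = 0}"
        using zariski_closed_subset[OF V[of k]] unfolding I_def by auto
    next
      fix z assume z: "z \<in> {z \<in> aff n. \<forall>f\<in>I k. f z = 0}"
      then have "\<forall>f\<in>Q. f z = 0" using QI by auto
      then show "z \<in> V k" using z unfolding Q(2) by simp
    qed
  qed
  have "\<forall>k. poly_ideal n (I k)"
    unfolding poly_ideal_def I_def
    by (auto intro: zero_in_poly_fun poly_fun_add poly_fun_mult)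
  moreover have "\<forall>k. I k \<subseteq> I (Suc k)"
  proof (intro allI subsetI)
    fix k f assume "f \<in> I k"
    then show "f \<in> I (Suc k)" using mono[of k] unfolding I_def by auto
  qed
  ultimately have "\<exists>m. \<forall>k\<ge>m. I k = I m"
    by (rule poly_acc[of n, unfolded poly_acc_def, THEN spec[of _ I], THEN mp, THEN mp])
  then obtain m where m: "\<forall>k\<ge>m. I k = I m" by (elim exE)
  have "V k = V m" if "k \<ge> m" for k
    unfolding VI[of k] VI[of m] m[rule_format, OF that] ..
  then show ?thesis by blast
qed

text \<open>Noetherian induction: a closed set that is neither empty nor irreducible splits into two
  smaller closed sets. The resulting family may be redundant.\<close>

lemma zariski_closed_decompose:
  assumes "zariski_closed n V"
  shows "\<exists>\<A>. finite \<A> \<and> (\<forall>A\<in>\<A>. zariski_irred n A) \<and> V = \<Union>\<A>"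
proof -
  define R where "R = {(A, B). zariski_closed n A \<and> zariski_closed n B \<and> A \<subset> B}"
  have "wf R" unfolding wf_iff_no_infinite_down_chain
  proof
    assume "\<exists>f. \<forall>i. (f (Suc i), f i) \<in> R"
    then obtain f where f: "\<And>i. (f (Suc i), f i) \<in> R" by blast
    have "zariski_closed n (f k)" "f (Suc k) \<subseteq> f k" for k using f[of k] unfolding R_def by auto
    from zariski_closed_dcc[of n f, OF this] obtain m where m: "\<forall>k\<ge>m. f k = f m" by (elim exE)
    have "f (Suc m) = f m" by (rule m[rule_format]) simp
    then show False using f[of m] unfolding R_def by auto
  qed
  then show ?thesis using assms
  proof (induction V rule: wf_induct_rule)
    case (less V)
    show ?case
    proof (cases "V = {} \<or> zariski_irred n V")
      case True
      then show ?thesis by (elim disjE) (auto intro: exI[of _ "{}"] exI[of _ "{V}"])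
    next
      case False
      then obtain A B where AB: "zariski_closed n A" "zariski_closed n B" "V = A \<union> B" "V \<noteq> A" "V \<noteq> B"
        using less.prems unfolding zariski_irred_def by blast
      have "(A, V) \<in> R" "(B, V) \<in> R" unfolding R_def using AB less.prems by auto
      from less.IH[OF this(1) AB(1)] less.IH[OF this(2) AB(2)] obtain \<A> \<B>
        where "finite \<A>" "\<forall>A\<in>\<A>. zariski_irred n A" "A = \<Union>\<A>"
          "finite \<B>" "\<forall>A\<in>\<B>. zariski_irred n A" "B = \<Union>\<B>" by blast
      then show ?thesis using AB(3) by (intro exI[of _ "\<A> \<union> \<B>"]) auto
    qed
  qed
qed

subsection \<open>Hyperplane sections of cones\<close>

text \<open>The coefficient vector (1, t, ..., t^(n-1)) runs along the moment curve; this
  one-parameter family is rich enough to provide generic hyperplanes.\<close>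

definition lin_form :: "nat \<Rightarrow> complex \<Rightarrow> (nat \<Rightarrow> complex) \<Rightarrow> complex" where
  "lin_form n t z = (\<Sum>i<n. t ^ i * z i)"

lemma lin_form_in_poly_fun: "lin_form n t \<in> poly_fun n"
proof -
  have "lin_form n t = (\<Sum>i<n. cscale (t ^ i) (\<lambda>z. z i))"
    by (simp add: fun_eq_iff lin_form_def sum_fun_apply)
  also have "\<dots> \<in> poly_fun n" by (intro poly_fun_sum poly_fun_scale var_in_poly_fun) simp
  finally show ?thesis .
qed

lemma homogeneous_lin_form: "homogeneous 1 (lin_form n t)"
  by (simp add: homogeneous_def lin_form_def sum_distrib_left mult_ac)

text \<open>For fixed nonzero \<open>p\<close> the value is a nonzero polynomial in \<open>t\<close>
  with coefficients \<open>p i\<close>, so every point of \<open>S\<close> excludes only finitely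
  many \<open>t\<close>.\<close>

lemma ex_lin_form_nonzero:
  assumes S: "finite S" "\<And>p. p \<in> S \<Longrightarrow> \<exists>i<n. p i \<noteq> 0"
  shows "\<exists>t. \<forall>p\<in>S. lin_form n t p \<noteq> 0"
proof -
  define q where "q p = (\<Sum>i<n. monom (p i) i)" for p :: "nat \<Rightarrow> complex"
  have q0: "q p \<noteq> 0" if p: "p \<in> S" for p
  proof -
    obtain i where i: "i < n" "p i \<noteq> 0" using S(2)[OF p] by blast
    have "coeff (q p) i = p i" using i by (simp add: q_def coeff_sum)
    then show ?thesis using i by auto
  qed
  have "finite (\<Union>p\<in>S. {t. poly (q p) t = 0})" using S(1) q0 poly_roots_finite by auto
  then obtain t where "t \<notin> (\<Union>p\<in>S. {t. poly (q p) t = 0})"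
    using ex_new_if_finite[OF infinite_UNIV_char_0] by blast
  moreover have "poly (q p) t = lin_form n t p" for p
    by (simp add: q_def lin_form_def poly_sum poly_monom mult.commute)
  ultimately show ?thesis by auto
qed

text \<open>The members of \<open>\<A>\<close> are not known to be cones. One of them, however,
  contains infinitely many points of the line through \<open>p\<close>; its equations then vanish on
  the whole line, in particular at the origin.\<close>

lemma ex_component_through_zero:
  assumes p: "p \<noteq> (\<lambda>_. 0)" and \<A>: "finite \<A>" "\<And>A. A \<in> \<A> \<Longrightarrow> zariski_closed n A"
    and line: "\<And>c. (\<lambda>k. c * p k) \<in> \<Union>\<A>"
  shows "\<exists>A\<in>\<A>. (\<lambda>_. 0) \<in> A \<and> \<not> A \<subseteq> {\<lambda>_. 0}"
proof -
  have "\<exists>A\<in>\<A>. infinite {c. (\<lambda>k. c * p k) \<in> A}"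
  proof (rule ccontr)
    assume "\<not> ?thesis"
    then have "finite (\<Union>A\<in>\<A>. {c. (\<lambda>k. c * p k) \<in> A})" using \<A>(1) by auto
    moreover have "(\<Union>A\<in>\<A>. {c. (\<lambda>k. c * p k) \<in> A}) = UNIV" using line by auto
    ultimately show False using infinite_UNIV_char_0[where 'a = complex] by simp
  qed
  then obtain A where A: "A \<in> \<A>" "infinite {c. (\<lambda>k. c * p k) \<in> A}" by blast
  obtain Q where Q: "Q \<subseteq> poly_fun n" "A = {z \<in> aff n. \<forall>f\<in>Q. f z = 0}"
    using \<A>(2)[OF A(1)] unfolding zariski_closed_iff by (elim exE conjE)
  have "f (\<lambda>_. 0) = 0" if f: "f \<in> Q" for f
  proof -
    have "f \<in> poly_fun n" using f Q(1) by blast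
    from poly_fun_on_line[OF this, of p] obtain q where q: "\<And>c. f (\<lambda>i. c * p i) = poly q c" by blast
    have "{c. (\<lambda>k. c * p k) \<in> A} \<subseteq> {c. poly q c = 0}" using f unfolding Q(2) q[symmetric] by auto
    then have "infinite {c. poly q c = 0}" using A(2) infinite_super by blast
    then have "q = 0" using poly_roots_finite by blast
    then show ?thesis using q[of 0] by simp
  qed
  then have "(\<lambda>_. 0) \<in> A" unfolding Q(2) by (simp add: aff_def)
  moreover have "\<not> A \<subseteq> {\<lambda>_. 0}"
  proof
    assume sub: "A \<subseteq> {\<lambda>_. 0}"
    obtain k where k: "p k \<noteq> 0" using p by auto
    have "c = 0" if "(\<lambda>k. c * p k) \<in> A" for c
    proof -
      have "(\<lambda>k. c * p k) = (\<lambda>_. 0)" using that sub by blast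
      then have "c * p k = 0" by (rule fun_cong)
      then show ?thesis using k by simp
    qed
    then have "{c. (\<lambda>k. c * p k) \<in> A} \<subseteq> {0}" by auto
    then show False using A(2) finite_subset by blast
  qed
  ultimately show ?thesis using A(1) by blast
qed

lemma irred_chain_extend:
  assumes "irred_chain n W k Z" "W \<subseteq> V" "zariski_irred n Y" "Y \<subseteq> V" "Z k \<subset> Y"
  shows "irred_chain n V (Suc k) (Z(Suc k := Y))"
proof -
  have Z: "zariski_irred n (Z i) \<and> Z i \<subseteq> V" if "i \<le> k" for i
    using assms(1,2) that unfolding irred_chain_def by blast
  show ?thesis using assms(1,3-5) Z unfolding irred_chain_def by (simp add: le_Suc_eq less_Suc_eq)
qed

text \<open>The hyperplane misses a nonzero point of every component that has one. The top of a
  chain in the section is therefore properly contained in a component of \<open>V\<close>, which can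
  be appended.\<close>

lemma hyperplane_section_chain:
  assumes V: "zariski_closed n V" "is_cone V" and p: "p \<in> V" "p \<noteq> (\<lambda>_. 0)"
  shows "\<exists>t. \<forall>k Z. irred_chain n (V \<inter> {z \<in> aff n. lin_form n t z = 0}) k Z \<longrightarrow>
    (\<exists>Z'. irred_chain n V (Suc k) Z')"
proof -
  obtain \<A> where \<A>: "finite \<A>" "\<And>A. A \<in> \<A> \<Longrightarrow> zariski_irred n A" "V = \<Union>\<A>"
    using zariski_closed_decompose[OF V(1)] by blast
  have cl: "zariski_closed n A" if "A \<in> \<A>" for A using \<A>(2)[OF that] by (simp add: zariski_irred_def)
  have "\<forall>A. \<exists>x. \<not> A \<subseteq> {\<lambda>_. 0} \<longrightarrow> x \<in> A \<and> x \<noteq> (\<lambda>_. 0 :: complex)" by blast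
  from choice[OF this] obtain pt where
    pt: "\<And>A. \<not> A \<subseteq> {\<lambda>_. 0 :: complex} \<Longrightarrow> pt A \<in> A \<and> pt A \<noteq> (\<lambda>_ :: nat. 0)" by blast
  have "\<exists>t. \<forall>x\<in>pt ` {A \<in> \<A>. \<not> A \<subseteq> {\<lambda>_. 0}}. lin_form n t x \<noteq> 0"
  proof (rule ex_lin_form_nonzero)
    fix x assume "x \<in> pt ` {A \<in> \<A>. \<not> A \<subseteq> {\<lambda>_. 0}}"
    then obtain A where A: "A \<in> \<A>" "x \<in> A" "x \<noteq> (\<lambda>_. 0)" using pt by blast
    then obtain i where i: "x i \<noteq> 0" by auto
    have "x \<in> aff n" using A zariski_closed_subset[OF cl] by blast
    then show "\<exists>i<n. x i \<noteq> 0" using i by (intro exI[of _ i]) (auto simp: aff_def not_le[symmetric])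
  qed (use \<A>(1) in simp)
  then obtain t where t: "\<And>A. A \<in> \<A> \<Longrightarrow> \<not> A \<subseteq> {\<lambda>_. 0} \<Longrightarrow> lin_form n t (pt A) \<noteq> 0" by blast
  let ?H = "{z \<in> aff n. lin_form n t z = 0}"
  have "\<exists>Z'. irred_chain n V (Suc k) Z'" if Z: "irred_chain n (V \<inter> ?H) k Z" for k Z
  proof -
    have Zk: "zariski_irred n (Z k)" "Z k \<subseteq> V \<inter> ?H" using Z unfolding irred_chain_def by auto
    have "\<exists>Y\<in>\<A>. Z k \<subset> Y"
    proof -
      obtain A where A: "A \<in> \<A>" "Z k \<subseteq> A"
        using zariski_irred_subset_Union[OF Zk(1) \<A>(1) cl] Zk(2) \<A>(3) by blast
      show ?thesis
      proof (cases "A \<subseteq> {\<lambda>_. 0}")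
        case False
        have "pt A \<notin> Z k" using t[OF A(1) False] Zk(2) by blast
        then have "Z k \<subset> A" using A(2) pt[OF False] by blast
        then show ?thesis using A(1) by blast
      next
        \<comment> \<open>The component is at most the origin and contains no point to be avoided.
          As \<open>V\<close> has the nonzero point \<open>p\<close>, some larger component passes
          through the origin and is appended instead.\<close>
        case True
        have "(\<lambda>k. c * p k) \<in> \<Union>\<A>" for c
          using V(2) p(1) unfolding \<A>(3)[symmetric] is_cone_def by blast
        from ex_component_through_zero[OF p(2) \<A>(1) cl this] obtain Y
          where Y: "Y \<in> \<A>" "(\<lambda>_. 0) \<in> Y" "\<not> Y \<subseteq> {\<lambda>_. 0}" by blast
        have "Z k \<subseteq> {\<lambda>_. 0}" using A(2) True by blast
        then have "Z k \<subset> Y" using Y by blast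
        then show ?thesis using Y(1) by blast
      qed
    qed
    then obtain Y where Y: "Y \<in> \<A>" "Z k \<subset> Y" by blast
    have "irred_chain n V (Suc k) (Z(Suc k := Y))"
      by (rule irred_chain_extend[OF Z _ \<A>(2)[OF Y(1)] _ Y(2)]) (use Y \<A>(3) in auto)
    then show ?thesis by (rule exI[of _ "Z(Suc k := Y)"])
  qed
  then show ?thesis by blast
qed

text \<open>Each section lowers the maximal chain length by at least one, because every chain in it
  can be lengthened in \<open>V\<close>.\<close>

lemma cone_cut_by_lin_forms:
  assumes "zariski_closed n V" "is_cone V" "\<And>k Z. irred_chain n V k Z \<Longrightarrow> k \<le> m"
  shows "\<exists>t. \<forall>z\<in>V. (\<forall>l<m. lin_form n (t l) z = 0) \<longrightarrow> z = (\<lambda>_. 0)"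
  using assms
proof (induction m arbitrary: V)
  case (0 V)
  have "z = (\<lambda>_. 0)" if z: "z \<in> V" for z
  proof (rule ccontr)
    assume "z \<noteq> (\<lambda>_. 0)"
    from hyperplane_section_chain[OF 0(1,2) z this] obtain t where
      t: "\<And>k Z. irred_chain n (V \<inter> {z \<in> aff n. lin_form n t z = 0}) k Z \<Longrightarrow>
        (\<exists>Z'. irred_chain n V (Suc k) Z')" by blast
    have "(\<lambda>k. 0 * z k) \<in> V" using 0(2) z unfolding is_cone_def by blast
    then have "(\<lambda>_. 0) \<in> V" by simp
    \<comment> \<open>The origin alone is a chain of length 0 in the section; lengthening it in
      \<open>V\<close> contradicts the bound 0.\<close>
    then have "irred_chain n (V \<inter> {z \<in> aff n. lin_form n t z = 0}) 0 (\<lambda>_. {\<lambda>_. 0})"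
      using zariski_irred_zero by (simp add: irred_chain_def lin_form_def aff_def)
    from t[OF this] obtain Z' where "irred_chain n V (Suc 0) Z'" by (elim exE)
    from 0(3)[OF this] show False by simp
  qed
  then show ?case by blast
next
  case (Suc m V)
  show ?case
  proof (cases "V \<subseteq> {\<lambda>_. 0}")
    case True
    then show ?thesis by blast
  next
    case False
    then obtain p where p: "p \<in> V" "p \<noteq> (\<lambda>_. 0)" by blast
    from hyperplane_section_chain[OF Suc.prems(1,2) p] obtain s where
      s: "\<And>k Z. irred_chain n (V \<inter> {z \<in> aff n. lin_form n s z = 0}) k Z \<Longrightarrow>
        (\<exists>Z'. irred_chain n V (Suc k) Z')" by blast
    let ?V = "V \<inter> {z \<in> aff n. lin_form n s z = 0}"
    have "\<exists>t. \<forall>z\<in>?V. (\<forall>l<m. lin_form n (t l) z = 0) \<longrightarrow> z = (\<lambda>_. 0)"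
    proof (rule Suc.IH)
      show "zariski_closed n ?V"
        by (intro zariski_closed_Int Suc.prems zariski_closed_hypersurface lin_form_in_poly_fun)
      show "is_cone ?V" using Suc.prems(2) homogeneous_lin_form[of n s]
        unfolding is_cone_def homogeneous_def by (auto simp: aff_def)
      show "k \<le> m" if Z: "irred_chain n ?V k Z" for k Z
      proof -
        from s[OF Z] obtain Z' where "irred_chain n V (Suc k) Z'" by (elim exE)
        from Suc.prems(3)[OF this] show ?thesis by simp
      qed
    qed
    then obtain t where t: "\<And>z. z \<in> ?V \<Longrightarrow> (\<forall>l<m. lin_form n (t l) z = 0) \<Longrightarrow> z = (\<lambda>_. 0)" by blast
    show ?thesis
    proof (intro exI[of _ "t(m := s)"] ballI impI)
      fix z assume z: "z \<in> V" "\<forall>l<Suc m. lin_form n ((t(m := s)) l) z = 0"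
      show "z = (\<lambda>_. 0)"
      proof (rule t)
        have "z \<in> aff n" using z(1) zariski_closed_subset[OF Suc.prems(1)] by blast
        moreover have "lin_form n s z = 0" using z(2)[rule_format, of m] by simp
        ultimately show "z \<in> ?V" using z(1) by blast
        show "\<forall>l<m. lin_form n (t l) z = 0"
        proof (intro allI impI)
          fix l assume "l < m"
          then show "lin_form n (t l) z = 0" using z(2)[rule_format, of l] by simp
        qed
      qed
    qed
  qed
qed

subsection \<open>Partial derivatives\<close>

text \<open>For a monomial free of variable \<open>j\<close> the truncated exponent
  \<open>0 - 1\<close> is 0, and the factor \<open>of_nat 0\<close> removes the term.\<close>

definition partial :: "nat \<Rightarrow> (mono \<Rightarrow>\<^sub>0 int) \<Rightarrow> nat \<Rightarrow> (nat \<Rightarrow> complex) \<Rightarrow> complex" where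
  "partial n F j = (\<Sum>m\<in>Poly_Mapping.keys F. cscale (of_int (Poly_Mapping.lookup F m) * of_nat (Poly_Mapping.lookup m j))
     (monom_fun n ((Poly_Mapping.lookup m)(j := Poly_Mapping.lookup m j - 1))))"

lemma partial_in_poly_fun: "partial n F j \<in> poly_fun n"
  unfolding partial_def
  by (intro poly_fun_sum poly_fun_scale) (simp add: poly_fun_def fv.span_base)

lemma monom_fun_has_derivative:
  assumes j: "j < n"
  shows "((\<lambda>u. monom_fun n e (z(j := u))) has_field_derivative
     of_nat (e j) * monom_fun n (e(j := e j - 1)) (z(j := u))) (at u)"
proof -
  have split: "monom_fun n e' (z(j := u)) = u ^ e' j * (\<Prod>i\<in>{..<n} - {j}. z i ^ e' i)" for e' u
    using j by (simp add: monom_fun_def prod.remove[of "{..<n}" j])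
  show ?thesis unfolding split by (auto intro!: derivative_eq_intros)
qed

lemma ieval_has_derivative:
  assumes F: "is_form n d F" and j: "j < n"
  shows "((\<lambda>u. ieval F (z(j := u))) has_field_derivative partial n F j (z(j := u))) (at u)"
proof -
  have "ieval F y = (\<Sum>m\<in>Poly_Mapping.keys F. of_int (Poly_Mapping.lookup F m) * monom_fun n (Poly_Mapping.lookup m) y)" for y
    unfolding ieval_def using F by (intro sum.cong refl) (auto simp: is_form_def mon_eval_eq_monom_fun)
  then show ?thesis unfolding partial_def sum_fun_apply cscale_apply
    by (simp only: mult.assoc) (intro DERIV_sum DERIV_cmult monom_fun_has_derivative[OF j])
qed

lemma pd_ieval: "is_form n d F \<Longrightarrow> j < n \<Longrightarrow> pd (ieval F) j z = partial n F j z"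
  unfolding pd_def using DERIV_imp_deriv[OF ieval_has_derivative[of n d F j z "z j"]] by simp

text \<open>Changing one of the variables \<open>w j\<close> and \<open>w (n + j)\<close> changes
  only the \<open>j\<close>-th product, linearly with the other variable as slope; the chain rule
  does the rest.\<close>

lemma pd_Gfun:
  assumes F: "is_form n d F" and j: "j < n"
  defines "\<zeta> \<equiv> \<lambda>w i. if i < n then w i * w (n + i) else 0"
  shows "pd (Gfun n F) j w = partial n F j (\<zeta> w) * w (n + j)"
    and "pd (Gfun n F) (n + j) w = partial n F j (\<zeta> w) * w j"
proof -
  have d: "((\<lambda>u. ieval F ((\<zeta> w)(j := u * c))) has_field_derivative
      partial n F j ((\<zeta> w)(j := x * c)) * c) (at x)" for c x
    by (rule DERIV_chain2[OF ieval_has_derivative[OF F j]]) (auto intro!: derivative_eq_intros)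
  have G1: "Gfun n F (w(j := u)) = ieval F ((\<zeta> w)(j := u * w (n + j)))" for u
  proof -
    have "(\<lambda>i. if i < n then (w(j := u)) i * (w(j := u)) (n + i) else 0) = (\<zeta> w)(j := u * w (n + j))"
      using j by (auto simp: \<zeta>_def fun_eq_iff)
    then show ?thesis unfolding Gfun_def by simp
  qed
  have G2: "Gfun n F (w(n + j := u)) = ieval F ((\<zeta> w)(j := u * w j))" for u
  proof -
    have "(\<lambda>i. if i < n then (w(n + j := u)) i * (w(n + j := u)) (n + i) else 0) = (\<zeta> w)(j := u * w j)"
      using j by (auto simp: \<zeta>_def fun_eq_iff)
    then show ?thesis unfolding Gfun_def by simp
  qed
  have triv: "(\<zeta> w)(j := w j * w (n + j)) = \<zeta> w" "(\<zeta> w)(j := w (n + j) * w j) = \<zeta> w"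
    using j by (auto simp: \<zeta>_def fun_eq_iff)
  show "pd (Gfun n F) j w = partial n F j (\<zeta> w) * w (n + j)"
    unfolding pd_def G1 using DERIV_imp_deriv[OF d[of "w (n + j)" "w j"]] by (simp add: triv)
  show "pd (Gfun n F) (n + j) w = partial n F j (\<zeta> w) * w j"
    unfolding pd_def G2 using DERIV_imp_deriv[OF d[of "w j" "w (n + j)"]] by (simp add: triv)
qed

lemma homogeneous_partial:
  assumes F: "is_form n d F" and j: "j < n"
  shows "homogeneous (d - 1) (partial n F j)"
  unfolding homogeneous_def
proof (intro allI)
  fix c z
  have "of_nat (Poly_Mapping.lookup m j) * monom_fun n ((Poly_Mapping.lookup m)(j := Poly_Mapping.lookup m j - 1)) (\<lambda>k. c * z k) =
     c ^ (d - 1) * (of_nat (Poly_Mapping.lookup m j) * monom_fun n ((Poly_Mapping.lookup m)(j := Poly_Mapping.lookup m j - 1)) z)"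
    if m: "m \<in> Poly_Mapping.keys F" for m
  proof (cases "Poly_Mapping.lookup m j = 0")
    case False
    let ?e = "Poly_Mapping.lookup m"
    have "d = (\<Sum>i\<in>Poly_Mapping.keys m. ?e i)" "Poly_Mapping.keys m \<subseteq> {..<n}"
      using F m by (auto simp: is_form_def mon_deg_def)
    then have "d = (\<Sum>i<n. ?e i)"
      by (simp, intro sum.mono_neutral_left) (auto simp: in_keys_iff)
    then have "(\<Sum>i<n. (?e(j := ?e j - 1)) i) = d - 1"
      using j False by (simp add: sum.remove[of "{..<n}" j])
    then show ?thesis unfolding monom_fun_homogeneous by simp
  qed simp
  then show "partial n F j (\<lambda>k. c * z k) = c ^ (d - 1) * partial n F j z"
    unfolding partial_def sum_fun_apply cscale_apply sum_distrib_left
    by (intro sum.cong refl) (simp add: mult.assoc mult.left_commute[of "c ^ (d - 1)"])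
qed

subsection \<open>Stratification by the vanishing coordinates\<close>

text \<open>On a stratum \<open>x\<^sub>i = z\<^sub>i / y\<^sub>i\<close> whenever \<open>y\<^sub>i \<noteq> 0\<close>. The functions spanning the restrictions of
  polynomials in \<open>hilb_le\<close> are arbitrary, so negative powers of these \<open>y\<^sub>i\<close> are allowed.\<close>

lemma hilb_le_stratum:
  fixes \<alpha> \<beta> :: "nat \<Rightarrow> nat"
  assumes inj: "inj_on \<alpha> {..<n}" "inj_on \<beta> {..<n}"
    and un: "{..<N} = \<alpha> ` {..<n} \<union> \<beta> ` {..<n}" and disj: "\<alpha> ` {..<n} \<inter> \<beta> ` {..<n} = {}"
  defines "\<zeta> \<equiv> \<lambda>w i. if i < n then w (\<alpha> i) * w (\<beta> i) else 0"
  assumes J: "J \<subseteq> {..<n}" and S: "\<And>w i. w \<in> S \<Longrightarrow> i < n \<Longrightarrow> w (\<beta> i) = 0 \<longleftrightarrow> i \<in> J"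
    and SW: "\<And>w. w \<in> S \<Longrightarrow> \<zeta> w \<in> W" and W: "hilb_le n W e"
  shows "hilb_le N S (n + e)"
proof -
  obtain C where C: "\<And>s. \<exists>T. finite T \<and> card T \<le> C * (s + 1) ^ e \<and> poly_fun_le n s \<subseteq> spanned_on W T"
    using W unfolding hilb_le_def by blast
  show ?thesis
  proof (rule hilb_leI[where C = "C * 2 ^ n"])
    fix s
    obtain T where T: "finite T" "card T \<le> C * (s + 1) ^ e" "poly_fun_le n s \<subseteq> spanned_on W T"
      using C[of s] by (elim exE conjE)
    \<comment> \<open>The free coordinates of the stratum: for \<open>i\<close> in \<open>J\<close>
      the coordinate \<open>w (\<beta> i)\<close> is zero and \<open>w (\<alpha> i)\<close> is
      unconstrained by the product; otherwise \<open>w (\<beta> i)\<close> is invertible and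
      determines \<open>w (\<alpha> i)\<close> from the product.\<close>
    define R where "R \<gamma> w = (\<Prod>i<n. w (if i \<in> J then \<alpha> i else \<beta> i) powi \<gamma> i)"
      for \<gamma> :: "nat \<Rightarrow> int" and w :: "nat \<Rightarrow> complex"
    \<comment> \<open>The exponents are at most \<open>s\<close> or differences of two such numbers,
      so each of the \<open>n\<close> positions has \<open>2 * s + 1\<close> choices; this explains
      the summand \<open>n\<close> in the growth and the factor \<open>2 ^ n\<close>.\<close>
    define \<Gamma> where "\<Gamma> = ({..<n} \<rightarrow>\<^sub>E {- int s..int s})"
    define U where "U = (\<lambda>(t, \<gamma>) w. t (\<zeta> w) * R \<gamma> w) ` (T \<times> \<Gamma>)"
    have fin: "finite \<Gamma>" unfolding \<Gamma>_def by (intro finite_PiE) auto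
    have "card U \<le> card (T \<times> \<Gamma>)" unfolding U_def using T(1) fin by (intro card_image_le) simp
    also have "\<dots> = card T * (2 * s + 1) ^ n"
    proof -
      have "card {- int s..int s} = 2 * s + 1" by simp
      then have "card \<Gamma> = (2 * s + 1) ^ n" unfolding \<Gamma>_def by (simp only: card_PiE finite_lessThan prod_constant card_lessThan)
      then show ?thesis by (simp only: card_cartesian_product)
    qed
    also have "\<dots> \<le> (C * (s + 1) ^ e) * (2 * (s + 1)) ^ n"
      by (intro mult_mono T(2) power_mono) auto
    also have "\<dots> = C * 2 ^ n * (s + 1) ^ (n + e)"
      unfolding power_mult_distrib power_add by (simp only: mult_ac)
    finally have "card U \<le> C * 2 ^ n * (s + 1) ^ (n + e)" .
    moreover have "finite U" unfolding U_def using T(1) fin by simp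
    moreover have "poly_fun_le N s \<subseteq> spanned_on S U"
    proof (rule poly_fun_le_spanned_onI)
      fix a :: "nat \<Rightarrow> nat" assume a: "(\<Sum>i<N. a i) \<le> s"
      have mon: "monom_fun N a w = (\<Prod>i<n. w (\<alpha> i) ^ a (\<alpha> i) * w (\<beta> i) ^ a (\<beta> i))" for w
        unfolding monom_fun_def un using disj
        by (simp add: prod.union_disjoint prod.reindex[OF inj(1)] prod.reindex[OF inj(2)] prod.distrib)
      have sum: "(\<Sum>i<N. a i) = (\<Sum>i<n. a (\<alpha> i)) + (\<Sum>i<n. a (\<beta> i))"
        unfolding un using disj
        by (simp add: sum.union_disjoint sum.reindex[OF inj(1)] sum.reindex[OF inj(2)])
      have le: "a (\<alpha> i) \<le> s" "a (\<beta> i) \<le> s" if "i < n" for i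
        using member_le_sum[of i "{..<n}" "\<lambda>i. a (\<alpha> i)"] member_le_sum[of i "{..<n}" "\<lambda>i. a (\<beta> i)"] that a
        unfolding sum by auto
      show "monom_fun N a \<in> spanned_on S U"
      proof (cases "\<exists>j\<in>J. a (\<beta> j) > 0")
        case True
        then obtain j where j: "j \<in> J" "a (\<beta> j) > 0" by blast
        have "monom_fun N a w = 0" if "w \<in> S" for w
        proof -
          have "w (\<beta> j) = 0" using S[OF that, of j] j J by auto
          then show ?thesis unfolding mon using j J by (intro prod_zero bexI[of _ j]) auto
        qed
        then show ?thesis by (intro spanned_on_cong[OF fv.subspace_0[OF subspace_spanned_on]]) auto
      next
        case False
        \<comment> \<open>For \<open>i\<close> outside \<open>J\<close>, x^p y^q = (xy)^p y^(q-p).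
          For \<open>i\<close> in \<open>J\<close> no power of the vanishing coordinate is left, and
          the power of \<open>w (\<alpha> i)\<close> goes into \<open>\<gamma>\<close>
          unchanged.\<close>
        define b where "b i = (if i \<in> J then 0 else a (\<alpha> i))" for i
        define \<gamma> where "\<gamma> = (\<lambda>i\<in>{..<n}. if i \<in> J then int (a (\<alpha> i)) else int (a (\<beta> i)) - int (a (\<alpha> i)))"
        have \<gamma>: "\<gamma> \<in> \<Gamma>" unfolding \<Gamma>_def
        proof (rule PiE_I)
          fix i assume "i \<in> {..<n}"
          then show "\<gamma> i \<in> {- int s..int s}" using le[of i] by (simp add: \<gamma>_def)
        qed (simp add: \<gamma>_def)
        have "(\<Sum>i<n. b i) \<le> (\<Sum>i<n. a (\<alpha> i))" by (intro sum_mono) (simp add: b_def)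
        then have "(\<Sum>i<n. b i) \<le> s" using a unfolding sum by simp
        then have "monom_fun n b \<in> poly_fun_le n s"
          unfolding poly_fun_le_def by (intro fv.span_base) auto
        then obtain g where g: "g \<in> fv.span T" "\<forall>z\<in>W. monom_fun n b z = g z"
          using T(3) unfolding spanned_on_def by auto
        have eq: "monom_fun N a w = g (\<zeta> w) * R \<gamma> w" if w: "w \<in> S" for w
        proof -
          have "monom_fun N a w = (\<Prod>i<n. \<zeta> w i ^ b i * w (if i \<in> J then \<alpha> i else \<beta> i) powi \<gamma> i)"
            unfolding mon
          proof (rule prod.cong[OF refl])
            fix i assume "i \<in> {..<n}"
            then have i: "i < n" by simp
            show "w (\<alpha> i) ^ a (\<alpha> i) * w (\<beta> i) ^ a (\<beta> i) =
              \<zeta> w i ^ b i * w (if i \<in> J then \<alpha> i else \<beta> i) powi \<gamma> i"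
            proof (cases "i \<in> J")
              case True
              then show ?thesis using False i by (simp add: b_def \<gamma>_def)
            next
              case iJ: False
              then have "w (\<beta> i) \<noteq> 0" using S[OF w i] by simp
              then show ?thesis using iJ i
                by (simp add: b_def \<gamma>_def \<zeta>_def power_int_diff power_mult_distrib)
            qed
          qed
          also have "\<dots> = monom_fun n b (\<zeta> w) * R \<gamma> w"
            by (simp add: monom_fun_def R_def prod.distrib)
          finally show ?thesis using g(2) SW[OF w] by simp
        qed
        have "fv.span T \<subseteq> {g. (\<lambda>w. g (\<zeta> w) * R \<gamma> w) \<in> fv.span U}"
        proof (rule fv.span_minimal)
          show "T \<subseteq> {g. (\<lambda>w. g (\<zeta> w) * R \<gamma> w) \<in> fv.span U}"
          proof (intro subsetI CollectI fv.span_base)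
            fix t assume "t \<in> T"
            then show "(\<lambda>w. t (\<zeta> w) * R \<gamma> w) \<in> U"
              unfolding U_def using \<gamma> by (intro image_eqI[of _ _ "(t, \<gamma>)"]) auto
          qed
          show "fv.subspace {g. (\<lambda>w. g (\<zeta> w) * R \<gamma> w) \<in> fv.span U}"
            unfolding fv.subspace_def
          proof (intro conjI ballI allI CollectI)
            have "(\<lambda>w. 0 (\<zeta> w) * R \<gamma> w) = 0" by auto
            then show "(\<lambda>w. 0 (\<zeta> w) * R \<gamma> w) \<in> fv.span U" by (simp only: fv.span_zero)
          next
            fix g h assume "g \<in> {g. (\<lambda>w. g (\<zeta> w) * R \<gamma> w) \<in> fv.span U}"
              "h \<in> {g. (\<lambda>w. g (\<zeta> w) * R \<gamma> w) \<in> fv.span U}"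
            then have "(\<lambda>w. g (\<zeta> w) * R \<gamma> w) + (\<lambda>w. h (\<zeta> w) * R \<gamma> w) \<in> fv.span U"
              by (intro fv.span_add) simp_all
            then show "(\<lambda>w. (g + h) (\<zeta> w) * R \<gamma> w) \<in> fv.span U"
              by (simp add: plus_fun_def distrib_right)
          next
            fix c g assume "g \<in> {g. (\<lambda>w. g (\<zeta> w) * R \<gamma> w) \<in> fv.span U}"
            then have "cscale c (\<lambda>w. g (\<zeta> w) * R \<gamma> w) \<in> fv.span U"
              by (intro fv.span_scale) simp
            then show "(\<lambda>w. cscale c g (\<zeta> w) * R \<gamma> w) \<in> fv.span U"
              by (simp add: cscale_def mult.assoc)
          qed
        qed
        then have "(\<lambda>w. g (\<zeta> w) * R \<gamma> w) \<in> fv.span U" using g(1) by auto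
        then show ?thesis unfolding spanned_on_def using eq
          by (intro CollectI bexI[of _ "\<lambda>w. g (\<zeta> w) * R \<gamma> w"]) auto
      qed
    qed
    ultimately show "\<exists>T. finite T \<and> card T \<le> C * 2 ^ n * (s + 1) ^ (n + e) \<and> poly_fun_le N s \<subseteq> spanned_on S T"
      by (intro exI[of _ U] conjI)
  qed
qed

text \<open>The maps \<open>\<alpha>\<close> and \<open>\<beta>\<close> give the positions of the
  two groups of variables; keeping them abstract serves both loci, which differ by exchanging the
  groups. The bound is \<open>n\<close> for the free coordinates plus half of
  \<open>n + \<delta>\<close>, with \<open>\<delta>\<close> the dimension of the singular
  locus.\<close>

lemma var_dim_critical_locus_le:
  fixes \<alpha> \<beta> :: "nat \<Rightarrow> nat"
  assumes d: "d > 1" and F: "is_form n d F"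
    and inj: "inj_on \<alpha> {..<n}" "inj_on \<beta> {..<n}"
    and un: "{..<N} = \<alpha> ` {..<n} \<union> \<beta> ` {..<n}" and disj: "\<alpha> ` {..<n} \<inter> \<beta> ` {..<n} = {}"
  defines "\<zeta> \<equiv> \<lambda>w i. if i < n then w (\<alpha> i) * w (\<beta> i) else 0"
  shows "var_dim N {w \<in> aff N. \<forall>j<n. partial n F j (\<zeta> w) * w (\<beta> j) = 0} \<le> (3 * n + var_dim n (VF n F)) div 2"
proof (rule var_dim_le_hilb)
  define \<delta> where "\<delta> = var_dim n (VF n F)"
  let ?S = "{w \<in> aff N. \<forall>j<n. partial n F j (\<zeta> w) * w (\<beta> j) = 0}"
  have VF: "VF n F = {z \<in> aff n. \<forall>j<n. partial n F j z = 0}"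
    using pd_ieval[OF F] by (auto simp: VF_def)
  have hom: "partial n F j (\<lambda>k. c * z k) = c ^ (d - 1) * partial n F j z" if "j < n" for j c z
    using homogeneous_partial[OF F that] by (simp add: homogeneous_def)
  have "zariski_closed n (VF n F)"
  proof -
    have "VF n F = {z \<in> aff n. \<forall>f\<in>partial n F ` {..<n}. f z = 0}" unfolding VF by auto
    then show ?thesis using partial_in_poly_fun by (simp only:) (intro zariski_closed_zeros, auto)
  qed
  moreover have "is_cone (VF n F)" unfolding is_cone_def VF using hom by (auto simp: aff_def)
  moreover have "k \<le> \<delta>" if "irred_chain n (VF n F) k Z" for k Z
    unfolding \<delta>_def using that by (rule irred_chain_le_var_dim)
  ultimately have "\<exists>t. \<forall>z\<in>VF n F. (\<forall>l<\<delta>. lin_form n (t l) z = 0) \<longrightarrow> z = (\<lambda>_. 0)"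
    by (rule cone_cut_by_lin_forms)
  then obtain t where t: "\<And>z. z \<in> VF n F \<Longrightarrow> (\<And>l. l < \<delta> \<Longrightarrow> lin_form n (t l) z = 0) \<Longrightarrow> z = (\<lambda>_. 0)"
    by blast
  define W where "W J = {z \<in> aff n. \<forall>f\<in>(\<lambda>j z. z j) ` J \<union> partial n F ` ({..<n} - J). f z = 0}" for J
  have W: "hilb_le n (W J) (min (n - card J) (card J + \<delta>))" if J: "J \<subseteq> {..<n}" for J
  proof -
    have "hilb_le n (W J) (n - card J)"
      by (rule hilb_le_mono[OF hilb_le_coordinate_subspace[OF J]]) (auto simp: W_def)
    \<comment> \<open>Indices below \<open>n\<close> stand for partial derivatives, those from
      \<open>n\<close> on for the \<open>\<delta>\<close> linear forms that cut the singular locus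
      down to the origin.\<close>
    moreover have "hilb_le n (W J) (card (J \<union> {n..<n + \<delta>}))"
    proof (rule hilb_le_of_forms)
      show "zariski_closed n (W J)" unfolding W_def
        using J partial_in_poly_fun var_in_poly_fun by (intro zariski_closed_zeros) auto
      show "is_cone (W J)" unfolding is_cone_def W_def using hom by (auto simp: aff_def)
      show "finite (J \<union> {n..<n + \<delta>})" using J finite_subset by auto
      let ?g = "\<lambda>l. if l < n then partial n F l else lin_form n (t (l - n))"
      let ?d = "\<lambda>l. if l < n then d - 1 else 1"
      show "?g l \<in> poly_fun n" for l using partial_in_poly_fun lin_form_in_poly_fun by simp
      show "homogeneous (?d l) (?g l)" for l using homogeneous_partial[OF F] homogeneous_lin_form by simp
      show "1 \<le> ?d l" for l using d by auto
      fix z assume z: "z \<in> W J" and g: "\<And>l. l \<in> J \<union> {n..<n + \<delta>} \<Longrightarrow> ?g l z = 0"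
      show "z = (\<lambda>_. 0)"
      proof (rule t)
        have "partial n F j z = 0" if j: "j < n" for j
        proof (cases "j \<in> J")
          case True
          then show ?thesis using g[of j] j by simp
        next
          case False
          then show ?thesis using z j by (auto simp: W_def)
        qed
        then show "z \<in> VF n F" using z unfolding VF by (simp add: W_def)
        show "lin_form n (t l) z = 0" if "l < \<delta>" for l using g[of "n + l"] that by simp
      qed
    qed
    moreover have "card (J \<union> {n..<n + \<delta>}) = card J + \<delta>"
    proof -
      have "J \<inter> {n..<n + \<delta>} = {}" using J by auto
      then show ?thesis using finite_subset[OF J] by (simp add: card_Un_disjoint)
    qed
    ultimately show ?thesis by (simp add: min_def)
  qed
  define S where "S J = {w \<in> ?S. \<forall>i<n. w (\<beta> i) = 0 \<longleftrightarrow> i \<in> J}" for J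
  have "hilb_le N (S J) ((3 * n + \<delta>) div 2)" if "J \<in> Pow {..<n}" for J
  proof -
    have J: "J \<subseteq> {..<n}" using that by simp
    have SJ: "w (\<beta> i) = 0 \<longleftrightarrow> i \<in> J" if "w \<in> S J" "i < n" for w i using that by (simp add: S_def)
    have SW: "\<zeta> w \<in> W J" if w: "w \<in> S J" for w
    proof -
      have "\<zeta> w j = 0" if j: "j \<in> J" for j
        using SJ[OF w, of j] j J by (auto simp: \<zeta>_def)
      moreover have "partial n F j (\<zeta> w) = 0" if j: "j < n" "j \<notin> J" for j
      proof -
        have "partial n F j (\<zeta> w) * w (\<beta> j) = 0" using w j(1) unfolding S_def by blast
        then show ?thesis using SJ[OF w j(1)] j(2) by simp
      qed
      moreover have "\<zeta> w \<in> aff n" by (simp add: aff_def \<zeta>_def)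
      ultimately show ?thesis unfolding W_def by auto
    qed
    \<comment> \<open>The minimum of \<open>n - card J\<close> and \<open>card J + \<delta>\<close>
      is at most their mean. The subtraction is not truncated because
      \<open>card J \<le> n\<close>.\<close>
    have "hilb_le N (S J) (n + min (n - card J) (card J + \<delta>))"
      by (rule hilb_le_stratum[where J = J, OF inj un disj J _ _ W[OF J]])
        (use SJ SW in \<open>simp_all add: \<zeta>_def\<close>)
    moreover have "card J \<le> n" using card_mono[OF finite_lessThan J] by simp
    ultimately show ?thesis by (elim hilb_le_mono) auto
  qed
  then have "hilb_le N (\<Union>J\<in>Pow {..<n}. S J) ((3 * n + \<delta>) div 2)" by (intro hilb_le_UN) simp
  moreover have "?S \<subseteq> (\<Union>J\<in>Pow {..<n}. S J)"
  proof
    fix w assume w: "w \<in> ?S"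
    show "w \<in> (\<Union>J\<in>Pow {..<n}. S J)"
      by (rule UN_I[of "{i. i < n \<and> w (\<beta> i) = 0}"]) (use w in \<open>auto simp: S_def\<close>)
  qed
  ultimately show "hilb_le N ?S ((3 * n + var_dim n (VF n F)) div 2)"
    unfolding \<delta>_def by (rule hilb_le_mono) simp
qed

theorem theorem5p1:
  fixes n d :: nat and F :: "mono \<Rightarrow>\<^sub>0 int"
  assumes "d > 1" and "is_form n d F"
  shows "min (codim (2*n) (VG1 n F)) (codim (2*n) (VG2 n F)) \<ge> codim n (VF n F) / 2"
proof -
  note F = assms(2)
  have inj: "inj_on (\<lambda>i. i) {..<n}" "inj_on (\<lambda>i. n + i) {..<n}" by (auto simp: inj_on_def)
  have img: "(\<lambda>i. n + i) ` {..<n} = {n..<2 * n}"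
    unfolding lessThan_atLeast0 by (simp add: mult_2)
  have un: "{..<2 * n} = (\<lambda>i. i) ` {..<n} \<union> (\<lambda>i. n + i) ` {..<n}" and
    disj: "(\<lambda>i. i) ` {..<n} \<inter> (\<lambda>i. n + i) ` {..<n} = {}" unfolding img by auto
  \<comment> \<open>For the second locus the roles of the two groups are exchanged, which also swaps
    the factors of each product.\<close>
  have comm: "(\<lambda>i. if i < n then w (n + i) * w i else 0) = (\<lambda>i. if i < n then w i * w (n + i) else 0)"
    for w :: "nat \<Rightarrow> complex" by (auto simp: mult.commute)
  have 1: "VG1 n F = {w \<in> aff (2 * n). \<forall>j<n.
      partial n F j (\<lambda>i. if i < n then w i * w (n + i) else 0) * w (n + j) = 0}"
    using pd_Gfun(1)[OF F] by (auto simp: VG1_def)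
  have 2: "VG2 n F = {w \<in> aff (2 * n). \<forall>j<n.
      partial n F j (\<lambda>i. if i < n then w (n + i) * w i else 0) * w j = 0}"
    using pd_Gfun(2)[OF F] by (auto simp: VG2_def comm)
  have "var_dim (2 * n) (VG1 n F) \<le> (3 * n + var_dim n (VF n F)) div 2"
    unfolding 1 by (rule var_dim_critical_locus_le[OF assms inj un disj])
  moreover have "var_dim (2 * n) (VG2 n F) \<le> (3 * n + var_dim n (VF n F)) div 2"
    unfolding 2 by (rule var_dim_critical_locus_le[OF assms inj(2,1) trans[OF un Un_commute] trans[OF Int_commute disj]])
  \<comment> \<open>With \<open>\<delta>\<close> the dimension of \<open>VF n F\<close>, this is 2n
    - (3n + \<delta>)/2 = (n - \<delta>)/2; rounding down in \<open>div\<close> only strengthens the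
    dimension bound.\<close>
  ultimately show ?thesis unfolding codim_def by (simp add: min_def) linarith
qed

end
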